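(* Let $G$ be any of the connected and simply connected real Lie groups $G_2, G_3, G_4^{00}, G_9, G_{10}^{\lambda}$ ($\lambda\in\mathbb{R}$), with Lie algebra $\mathcal{G}$. Let $V=\{(x_1^*,\dots,x_5^*,x^*,y^* )\in\mathcal{G}^*: x_4^*x_5^*\neq 0\}$, an open submanifold of $\mathcal{G}^*\equiv\mathbb{R}^7$, and let $\mathcal{F}_G$ be the family of all coadjoint orbits $\Omega_F$ of $G$ with $F\in V$ (these orbits are contained in $V$ and are $6$-dimensional). Then $\mathcal{F}_G$ forms a measurable foliation (in the sense of Connes) on $V$; that is, the orbits in $\mathcal{F}_G$ are the leaves of a $6$-dimensional foliation of $V$, and this foliation is measurable.
   Context: Each Lie algebra below is a $7$-dimensional real Lie algebra with basis $(X_1,X_2,X_3,X_4,X_5,X,Y)$. In all of them $[X_1,X_2]=X_4$, $[X_1,X_3]=X_5$, $[X,Y]=0$. The remaining non-zero brackets (up to antisymmetry) are: - $\mathcal{G}_2$: $[X,X_1]=X_1,\ [X,X_4]=X_4,\ [X,X_5]=X_5,\ [Y,X_3]=X_3,\ [Y,X_5]=X_5$. - $\mathcal{G}_3$: $[X,X_2]=X_2,\ [X,X_4]=X_4,\ [Y,X_3]=X_3,\ [Y,X_5]=X_5$. - $\mathcal{G}_4^{00}$: $[X,X_1]=X_1,\ [X,X_4]=X_4,\ [X,X_5]=X_5,\ [Y,X_2]=X_2,\ [Y,X_4]=X_4$. - $\mathcal{G}_9$: $[X,X_3]=X_3,\ [X,X_5]=X_5,\ [Y,X_2]=X_2,\ [Y,X_4]=X_4,\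 [Y,X_3]=X_5$. - $\mathcal{G}_{10}^{\lambda}$ ($\lambda\in\mathbb{R}$): $[X,X_2]=X_2,\ [X,X_3]=\lambda X_3,\ [X,X_4]=X_4,\ [X,X_5]=\lambda X_5,\ [Y,X_3]=X_3+X_5,\ [Y,X_5]=X_5$. $G_2,G_3,G_4^{00},G_9,G_{10}^{\lambda}$ denote the corresponding connected and simply connected real Lie groups. Coordinates $(x_1^*,\dots,x_5^*,x^*,y^* )$ on $\mathcal{G}^*$ are taken with respect to the dual basis $(X_1^*,\dots,X_5^*,X^*,Y^* )$. The coadjoint representation is $\langle K(g)F,Z\rangle=\langle F,\mathrm{Ad}(g^{-1})Z\rangle$ and $\Omega_F=\{K(g)F:g\in G\}$. A foliation $(V,\mathcal{F})$ on a smooth manifold $V$ is given by an integrable smooth subbundle $\mathcal{F}\subset TV$; its leaves are the maximal connected submanifolds $L$ with $T_xL=\mathcal{F}_x$ for all $x\in L$. A partition of $V$ into $k$-dimensional submanifolds forms a foliation if there is an integrable $k$-dimensional subbundle whose leaves are exactly the members of the partition. A transversal is a submanifold $N\subset V$ with $T_xV=T_xN\oplus\mathcal{F}_x$ for all $x\in N$. A Borel transversal is a Borel subset $B\subset V$ such that $B\cap L$ is countable for every leaf $L$. A transverse measure for $(V,\mathcal{F})$ is a $\sigma$-additive map $B\mapsto\Lambda(B)$ from the set of all Borel transversals to $[0,+\infty]$ such that (i) if $\psi:B_1\to B_2$ is a Borel bijection and $\psi(x)$ lies on the leaf of $x$ for every $x\in B_1$, then $\Lambda(B_1)=\Lambda(B_2)$;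 (ii) $\Lambda(K)<+\infty$ for every compact subset $K$ of a smooth transversal submanifold of $V$. A measurable foliation is a foliation equipped with some transverse measure. Transverse measures correspond bijectively to equivalence classes of pairs $(\mathfrak{X},\mu)$, where (with $\mathcal{F}$ oriented, $k=\dim\mathcal{F}$) $\mathfrak{X}$ is a smooth positive (nowhere zero) $k$-vector field, a section of $\Lambda^k(\mathcal{F})^+$, and $\mu$ is an $\mathfrak{X}$-invariant measure on $V$: in every foliation chart $U\cong N\times\Pi$ ($N$ a transversal, $\Pi$ a plaque), where $\mu$ restricts to a product $\mu_N\times\mu_\Pi$, the measure $\mu_{\mathfrak{X}}$ on leaves determined by the volume element $\mathfrak{X}$ is proportional to $\mu_\Pi$. Pairs $(\mathfrak{X},\mu)$ and $(\mathfrak{Y},\nu)$ are equivalent if $\mathfrak{Y}=\varphi\mathfrak{X}$ and $\mu=\varphi\nu$ for some $\varphi\in C^\infty(V)$. *)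

theory Defs
  imports "HOL-Analysis.Analysis" "HOL-Algebra.Group"
begin

section \<open>Smooth maps between open subsets of normed spaces\<close>

primrec Ck_on :: "nat \<Rightarrow> 'a::real_normed_vector set \<Rightarrow> ('a \<Rightarrow> 'b::real_normed_vector) \<Rightarrow> bool"
  where
    "Ck_on 0 S f \<longleftrightarrow> continuous_on S f"
  | "Ck_on (Suc k) S f \<longleftrightarrow>
       (\<forall>x\<in>S. f differentiable (at x)) \<and>
       (\<forall>v. Ck_on k S (\<lambda>x. frechet_derivative f (at x) v))"

text \<open>Only meaningful for open \<open>S\<close> (derivatives are taken at \<open>at x\<close>), and for a
  finite-dimensional domain, where directional derivatives in all directions suffice.\<close>

definition smooth_on :: "'a::euclidean_space set \<Rightarrow> ('a \<Rightarrow> 'b::real_normed_vector) \<Rightarrow> bool"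
  where "smooth_on S f \<longleftrightarrow> (\<forall>k. Ck_on k S f)"


section \<open>Lie groups\<close>

text \<open>A chart is a pair of a domain and a total function, of which only the values on the
  domain matter; its inverse is \<open>inv_into U \<phi>\<close>.\<close>

type_synonym ('g, 'e) chart = "'g set \<times> ('g \<Rightarrow> 'e)"

definition is_chart :: "('g::topological_space, 'e::euclidean_space) chart \<Rightarrow> bool"
  where "is_chart = (\<lambda>(U, \<phi>). open U \<and> open (\<phi> ` U) \<and>
           homeomorphism U (\<phi> ` U) \<phi> (inv_into U \<phi>))"

definition smooth_atlas :: "('g::topological_space, 'e::euclidean_space) chart set \<Rightarrow> bool"
  where "smooth_atlas A \<longleftrightarrow>
           (\<forall>c\<in>A. is_chart c) \<and> \<Union>(fst ` A) = UNIV \<and>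
           (\<forall>(U, \<phi>)\<in>A. \<forall>(W, \<psi>)\<in>A. smooth_on (\<phi> ` (U \<inter> W)) (\<psi> \<circ> inv_into U \<phi>))"

definition prod_atlas ::
    "('g, 'e) chart set \<Rightarrow> ('h, 'f) chart set \<Rightarrow> ('g \<times> 'h, 'e \<times> 'f) chart set"
  where "prod_atlas A B = {(U \<times> W, map_prod \<phi> \<psi>) | U \<phi> W \<psi>. (U, \<phi>) \<in> A \<and> (W, \<psi>) \<in> B}"

definition smooth_map ::
    "('g::topological_space, 'e::euclidean_space) chart set \<Rightarrow>
     ('h::topological_space, 'f::euclidean_space) chart set \<Rightarrow> ('g \<Rightarrow> 'h) \<Rightarrow> bool"
  where "smooth_map A B f \<longleftrightarrow> continuous_on UNIV f \<and>
           (\<forall>(U, \<phi>)\<in>A. \<forall>(W, \<psi>)\<in>B. smooth_on (\<phi> ` (U \<inter> f -` W)) (\<psi> \<circ> f \<circ> inv_into U \<phi>))"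

text \<open>The underlying set of the group is the whole type \<open>'g\<close>, whose topology (Hausdorff and
  second countable, by its type classes) is the manifold topology.\<close>

definition lie_group ::
    "'g::{t2_space, second_countable_topology} monoid \<Rightarrow> ('g, 'e::euclidean_space) chart set \<Rightarrow> bool"
  where "lie_group G A \<longleftrightarrow>
           group G \<and> carrier G = UNIV \<and> smooth_atlas A \<and>
           smooth_map (prod_atlas A A) A (\<lambda>(x, y). x \<otimes>\<^bsub>G\<^esub> y) \<and>
           smooth_map A A (\<lambda>x. inv\<^bsub>G\<^esub> x)"

text \<open>The tangent space at the identity is identified with the model space \<open>'e\<close> through a
  chart \<open>c\<close> around the identity. \<open>Ad\<close> is the differential at the identity of conjugation, and the
  Lie bracket is \<open>[u, v] = ad u v\<close>, where \<open>ad\<close> is the differential of \<open>Ad\<close> at the identity.\<close>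

definition Ad :: "'g monoid \<Rightarrow> ('g, 'e::euclidean_space) chart \<Rightarrow> 'g \<Rightarrow> 'e \<Rightarrow> 'e"
  where "Ad G c g = (case c of (U, \<phi>) \<Rightarrow>
           frechet_derivative (\<lambda>y. \<phi> (g \<otimes>\<^bsub>G\<^esub> inv_into U \<phi> y \<otimes>\<^bsub>G\<^esub> inv\<^bsub>G\<^esub> g)) (at (\<phi> \<one>\<^bsub>G\<^esub>)))"

definition group_bracket ::
    "'g monoid \<Rightarrow> ('g, 'e::euclidean_space) chart \<Rightarrow> 'e \<Rightarrow> 'e \<Rightarrow> 'e"
  where "group_bracket G c u v = (case c of (U, \<phi>) \<Rightarrow>
           vector_derivative (\<lambda>t::real. Ad G c (inv_into U \<phi> (\<phi> \<one>\<^bsub>G\<^esub> + t *\<^sub>R u)) v) (at 0))"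

definition lie_algebra_iso :: "('a::real_vector \<Rightarrow> 'a \<Rightarrow> 'a) \<Rightarrow> ('b::real_vector \<Rightarrow> 'b \<Rightarrow> 'b) \<Rightarrow> ('a \<Rightarrow> 'b) \<Rightarrow> bool"
  where "lie_algebra_iso br br' \<theta> \<longleftrightarrow>
           linear \<theta> \<and> bij \<theta> \<and> (\<forall>x y. \<theta> (br x y) = br' (\<theta> x) (\<theta> y))"


section \<open>The Lie algebras\<close>

text \<open>Index set of the basis; \<open>XX\<close> and \<open>YY\<close> stand for the basis vectors \<open>X\<close> and \<open>Y\<close>.\<close>

datatype coord = X1 | X2 | X3 | X4 | X5 | XX | YY

instance coord :: finite
proof
  have "(UNIV :: coord set) \<subseteq> {X1, X2, X3, X4, X5, XX, YY}"
    using coord.exhaust by auto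
  then show "finite (UNIV :: coord set)"
    by (rule finite_subset) simp
qed

abbreviation bas :: "coord \<Rightarrow> real ^ coord"
  where "bas i \<equiv> axis i 1"

text \<open>An entry \<open>(i, j, v)\<close> of a bracket table says \<open>[bas i, bas j] = v\<close>; the bracket is extended
  by antisymmetry and bilinearity, and is zero on pairs that are not listed.\<close>

definition bracket_of :: "(coord \<times> coord \<times> (real ^ coord)) list \<Rightarrow> real ^ coord \<Rightarrow> real ^ coord \<Rightarrow> real ^ coord"
  where "bracket_of tab x y = (\<Sum>(i, j, v)\<leftarrow>tab. (x $ i * y $ j - x $ j * y $ i) *\<^sub>R v)"

definition bracket_G2 :: "real ^ coord \<Rightarrow> real ^ coord \<Rightarrow> real ^ coord"
  where "bracket_G2 = bracket_of
    [(X1, X2, bas X4), (X1, X3, bas X5),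
     (XX, X1, bas X1), (XX, X4, bas X4), (XX, X5, bas X5),
     (YY, X3, bas X3), (YY, X5, bas X5)]"

definition bracket_G3 :: "real ^ coord \<Rightarrow> real ^ coord \<Rightarrow> real ^ coord"
  where "bracket_G3 = bracket_of
    [(X1, X2, bas X4), (X1, X3, bas X5),
     (XX, X2, bas X2), (XX, X4, bas X4),
     (YY, X3, bas X3), (YY, X5, bas X5)]"

definition bracket_G4_00 :: "real ^ coord \<Rightarrow> real ^ coord \<Rightarrow> real ^ coord"
  where "bracket_G4_00 = bracket_of
    [(X1, X2, bas X4), (X1, X3, bas X5),
     (XX, X1, bas X1), (XX, X4, bas X4), (XX, X5, bas X5),
     (YY, X2, bas X2), (YY, X4, bas X4)]"

definition bracket_G9 :: "real ^ coord \<Rightarrow> real ^ coord \<Rightarrow> real ^ coord"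
  where "bracket_G9 = bracket_of
    [(X1, X2, bas X4), (X1, X3, bas X5),
     (XX, X3, bas X3), (XX, X5, bas X5),
     (YY, X2, bas X2), (YY, X4, bas X4), (YY, X3, bas X5)]"

definition bracket_G10 :: "real \<Rightarrow> real ^ coord \<Rightarrow> real ^ coord \<Rightarrow> real ^ coord"
  where "bracket_G10 l = bracket_of
    [(X1, X2, bas X4), (X1, X3, bas X5),
     (XX, X2, bas X2), (XX, X3, l *\<^sub>R bas X3), (XX, X4, bas X4), (XX, X5, l *\<^sub>R bas X5),
     (YY, X3, bas X3 + bas X5), (YY, X5, bas X5)]"


section \<open>Coadjoint orbits\<close>

text \<open>An element \<open>F\<close> of the dual is given by its coordinates in the dual basis, so its pairing
  with \<open>Z\<close> is \<open>F \<bullet> Z\<close>. The map \<open>\<theta>\<close> identifies \<open>real ^ coord\<close> with the Lie algebra of \<open>G\<close>; the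
  \<open>i\<close>-th coordinate of \<open>K(g) F\<close> is the pairing of \<open>F\<close> with \<open>Ad(g\<^sup>-\<^sup>1) (bas i)\<close>.\<close>

definition coadjoint ::
    "'g monoid \<Rightarrow> ('g, 'e::euclidean_space) chart \<Rightarrow> (real ^ coord \<Rightarrow> 'e) \<Rightarrow>
     'g \<Rightarrow> real ^ coord \<Rightarrow> real ^ coord"
  where "coadjoint G c \<theta> g F =
           (\<chi> i. F \<bullet> inv_into UNIV \<theta> (Ad G c (inv\<^bsub>G\<^esub> g) (\<theta> (bas i))))"

definition coadjoint_orbit ::
    "'g monoid \<Rightarrow> ('g, 'e::euclidean_space) chart \<Rightarrow> (real ^ coord \<Rightarrow> 'e) \<Rightarrow>
     real ^ coord \<Rightarrow> (real ^ coord) set"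
  where "coadjoint_orbit G c \<theta> F = {coadjoint G c \<theta> g F | g. g \<in> carrier G}"


section \<open>Submanifolds of Euclidean space\<close>

definition embedded_submanifold :: "nat \<Rightarrow> 'a::euclidean_space set \<Rightarrow> bool"
  where "embedded_submanifold k S \<longleftrightarrow>
           (\<forall>x\<in>S. \<exists>U \<Phi> \<Psi> H. open U \<and> x \<in> U \<and> open (\<Phi> ` U) \<and>
              smooth_on U (\<Phi> :: 'a \<Rightarrow> 'a) \<and> smooth_on (\<Phi> ` U) (\<Psi> :: 'a \<Rightarrow> 'a) \<and>
              (\<forall>y\<in>U. \<Psi> (\<Phi> y) = y) \<and>
              subspace H \<and> dim H = k \<and> \<Phi> ` (U \<inter> S) = \<Phi> ` U \<inter> H)"

text \<open>A submanifold need not be embedded (leaves of foliations in general are not). It is given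
  by its own topology \<open>T\<close>, with underlying set \<open>topspace T\<close>, and is locally (for \<open>T\<close>) an embedded
  submanifold carrying the subspace topology. An embedded submanifold \<open>S\<close> is the case
  \<open>T = top_of_set S\<close>.\<close>

definition submanifold :: "nat \<Rightarrow> 'a::euclidean_space topology \<Rightarrow> bool"
  where "submanifold k T \<longleftrightarrow> second_countable T \<and>
           (\<forall>x\<in>topspace T. \<exists>S. openin T S \<and> x \<in> S \<and>
              subtopology T S = top_of_set S \<and> embedded_submanifold k S)"

text \<open>Tangent vectors are the velocities of smooth curves in the submanifold.\<close>

definition tangent_space :: "'a::euclidean_space topology \<Rightarrow> 'a \<Rightarrow> 'a set"
  where "tangent_space T x =
           {v. \<exists>\<epsilon>>0. \<exists>\<gamma> :: real \<Rightarrow> 'a. \<gamma> 0 = x \<and> smooth_on {-\<epsilon><..<\<epsilon>} \<gamma> \<and>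
                 continuous_map (top_of_set {-\<epsilon><..<\<epsilon>}) T \<gamma> \<and>
                 (\<gamma> has_vector_derivative v) (at 0)}"


section \<open>Foliations of open subsets of Euclidean space\<close>

text \<open>The tangent bundle of the open set \<open>V\<close> is \<open>V \<times> UNIV\<close>, so that a subbundle of rank \<open>k\<close> is a
  family of \<open>k\<close>-dimensional subspaces that locally has a smooth frame.\<close>

definition smooth_subbundle :: "'a::euclidean_space set \<Rightarrow> nat \<Rightarrow> ('a \<Rightarrow> 'a set) \<Rightarrow> bool"
  where "smooth_subbundle V k D \<longleftrightarrow>
           (\<forall>x\<in>V. subspace (D x) \<and> dim (D x) = k) \<and>
           (\<forall>x\<in>V. \<exists>U s. open U \<and> x \<in> U \<and> U \<subseteq> V \<and>
              (\<forall>i<k. smooth_on U (s i)) \<and>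
              (\<forall>y\<in>U. D y = span {s i y | i :: nat. i < k}))"

definition integral_submanifold ::
    "'a::euclidean_space set \<Rightarrow> nat \<Rightarrow> ('a \<Rightarrow> 'a set) \<Rightarrow> 'a topology \<Rightarrow> bool"
  where "integral_submanifold V k D T \<longleftrightarrow>
           submanifold k T \<and> topspace T \<subseteq> V \<and> (\<forall>x\<in>topspace T. tangent_space T x = D x)"

definition foliation :: "'a::euclidean_space set \<Rightarrow> nat \<Rightarrow> ('a \<Rightarrow> 'a set) \<Rightarrow> bool"
  where "foliation V k D \<longleftrightarrow> open V \<and> smooth_subbundle V k D \<and>
           (\<forall>x\<in>V. \<exists>T. integral_submanifold V k D T \<and> x \<in> topspace T)"

definition leaves :: "'a::euclidean_space set \<Rightarrow> nat \<Rightarrow> ('a \<Rightarrow> 'a set) \<Rightarrow> 'a set set"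
  where "leaves V k D =
           {L. L \<noteq> {} \<and>
               (\<exists>T. integral_submanifold V k D T \<and> connected_space T \<and> topspace T = L) \<and>
               (\<forall>T. integral_submanifold V k D T \<and> connected_space T \<and> L \<subseteq> topspace T
                    \<longrightarrow> topspace T = L)}"


section \<open>Transverse measures\<close>

definition transversal ::
    "'a::euclidean_space set \<Rightarrow> ('a \<Rightarrow> 'a set) \<Rightarrow> 'a topology \<Rightarrow> bool"
  where "transversal V D N \<longleftrightarrow> (\<exists>m. submanifold m N) \<and> topspace N \<subseteq> V \<and>
           (\<forall>x\<in>topspace N. {u + w | u w. u \<in> tangent_space N x \<and> w \<in> D x} = UNIV \<and>
                            tangent_space N x \<inter> D x = {0})"

definition borel_transversals ::
    "'a::euclidean_space set \<Rightarrow> nat \<Rightarrow> ('a \<Rightarrow> 'a set) \<Rightarrow> 'a set set"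
  where "borel_transversals V k D =
           {B \<in> sets borel. B \<subseteq> V \<and> (\<forall>L\<in>leaves V k D. countable (B \<inter> L))}"

text \<open>The values of \<open>\<Lambda>\<close> on sets that are not Borel transversals are irrelevant. Every compact
  subset of a transversal is a Borel transversal.\<close>

definition transverse_measure ::
    "'a::euclidean_space set \<Rightarrow> nat \<Rightarrow> ('a \<Rightarrow> 'a set) \<Rightarrow> ('a set \<Rightarrow> ennreal) \<Rightarrow> bool"
  where "transverse_measure V k D \<Lambda> \<longleftrightarrow>
           positive (borel_transversals V k D) \<Lambda> \<and>
           countably_additive (borel_transversals V k D) \<Lambda> \<and>
           (\<forall>B1\<in>borel_transversals V k D. \<forall>B2\<in>borel_transversals V k D. \<forall>\<psi>.
              bij_betw \<psi> B1 B2 \<and> \<psi> \<in> restrict_space borel B1 \<rightarrow>\<^sub>M restrict_space borel B2 \<and>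
              (\<forall>x\<in>B1. \<exists>L\<in>leaves V k D. x \<in> L \<and> \<psi> x \<in> L)
              \<longrightarrow> \<Lambda> B1 = \<Lambda> B2) \<and>
           (\<forall>N K. transversal V D N \<and> compactin N K \<longrightarrow> \<Lambda> K < \<infinity>)"

text \<open>The zero map satisfies all the conditions on a transverse measure and would make every
  foliation measurable, so it is excluded.\<close>

definition measurable_foliation ::
    "'a::euclidean_space set \<Rightarrow> nat \<Rightarrow> ('a \<Rightarrow> 'a set) \<Rightarrow> bool"
  where "measurable_foliation V k D \<longleftrightarrow> foliation V k D \<and>
           (\<exists>\<Lambda>. transverse_measure V k D \<Lambda> \<and> (\<exists>B\<in>borel_transversals V k D. \<Lambda> B \<noteq> 0))"

end

theory Submission
  imports Defs
begin

text \<open>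
  Write \<open>x1, ..., x5, x, y\<close> for the coordinates of a functional. For each of the five algebras there
  is an explicit smooth function \<open>f\<close> on \<open>V\<close>, affine in \<open>x2\<close> with nowhere vanishing leading coefficient,
  whose differential at \<open>F\<close> has exactly the tangent space of the coadjoint orbit of \<open>F\<close> as its kernel:

    \<^item> \<open>bracket_G2\<close>: \<open>x4 (x2/x4 - x3/x5)\<close>;
    \<^item> \<open>bracket_G3\<close>: \<open>x2/x4 - x3/x5\<close>;
    \<^item> \<open>bracket_G4_00\<close>: \<open>x5 (x2/x4 - x3/x5)\<close>;
    \<^item> \<open>bracket_G9\<close>: \<open>x2/x4 - x3/x5 + ln \<bar>x4\<bar>\<close>;
    \<^item> \<open>bracket_G10 l\<close>: \<open>x2/x4 - x3/x5 + ln \<bar>x5\<bar> - l ln \<bar>x4\<bar>\<close>.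

  Replacing the coordinate \<open>x2\<close> by \<open>f\<close> is therefore a diffeomorphism of \<open>V\<close> that turns the level sets
  of \<open>f\<close> into parallel hyperplanes. Within one of the four quadrants \<open>sgn x4 = s, sgn x5 = t\<close> such a
  hyperplane section is convex, so the leaves of the foliation \<open>ker df\<close> are the fibres of
  \<open>(sgn x4, sgn x5, f)\<close>. This is the content of the locale \<open>straightened_foliation\<close>; maximality of these
  leaves comes from \<open>integral_submanifold_in_leaf\<close>, a connected integral submanifold having no way to
  leave a fibre.

  That these fibres are the orbits is \<open>orbit_eq_leaf\<close>. The lines spanned by \<open>X4\<close> and by \<open>X5\<close> are ideals,
  so \<open>Ad\<close> of a connected group multiplies \<open>X4\<close> and \<open>X5\<close> by positive numbers and orbits stay in a quadrant;
  and \<open>f\<close> has zero derivative along every orbit, hence is constant on it. Conversely the orbit map has a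
  derivative onto the tangent space of the leaf, so every orbit is open in its leaf, and a connected
  leaf cannot be split into several open orbits. The link between group and
  algebra is that the bracket is the derivative of \<open>Ad\<close> at the identity (\<open>Adj_has_derivative\<close>), and that a
  function on a connected Lie group is constant once all its left translates have zero derivative at the
  identity (\<open>constant_if_left_derivative_zero\<close>).

  Finally, the leaves are closed in \<open>V\<close>, and a transversal meets each of them in isolated points
  (\<open>transversal_meets_leaf_isolated\<close>). Counting the points of a Borel transversal on one chosen leaf is
  thus finite on compact subsets of transversals; it is countably additive, and invariant under maps that
  slide points along leaves, so it is a nonzero transverse measure.
\<close>

section \<open>Calculus of smooth maps\<close>

lemma Ck_on_subset: "Ck_on k S f \<Longrightarrow> T \<subseteq> S \<Longrightarrow> Ck_on k T f"
  by (induction k arbitrary: f) (auto intro: continuous_on_subset)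

text \<open>\<open>Ck_on\<close> is recursive in the chosen derivative, which depends only on the germ of the function; on an
  open set, equal functions therefore have equal derivatives at every stage of the recursion.\<close>

lemma Ck_on_cong_imp:
  assumes "open S" "\<And>x. x \<in> S \<Longrightarrow> f x = g x" "Ck_on k S f"
  shows "Ck_on k S g"
  using assms(2,3)
proof (induction k arbitrary: f g)
  case 0
  then show ?case
    using continuous_on_cong by fastforce
next
  case (Suc k)
  have D: "(f has_derivative f') (at x) \<longleftrightarrow> (g has_derivative f') (at x)" if "x \<in> S" for x f'
    using has_derivative_transform_within_open[OF _ \<open>open S\<close> that] Suc.prems(1) by metis
  then have "frechet_derivative f (at x) = frechet_derivative g (at x)" if "x \<in> S" for x
    using that by (auto simp: frechet_derivative_def)
  moreover have "\<forall>x\<in>S. g differentiable (at x)"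
    using D Suc.prems(2) unfolding Ck_on.simps differentiable_def by blast
  moreover have "Ck_on k S (\<lambda>x. frechet_derivative g (at x) v)" for v
    by (rule Suc.IH[of "\<lambda>x. frechet_derivative f (at x) v"]) (use calculation Suc.prems(2) in auto)
  ultimately show ?case by simp
qed

lemma Ck_on_cong:
  assumes "open S" "\<And>x. x \<in> S \<Longrightarrow> f x = g x"
  shows "Ck_on k S f \<longleftrightarrow> Ck_on k S g"
  using Ck_on_cong_imp[OF assms(1)] assms(2) by metis

text \<open>The form in which the recursion is used below: any formula for the derivative may stand in for
  \<open>frechet_derivative\<close>.\<close>

lemma Ck_on_SucI:
  assumes "open S" "\<And>x. x \<in> S \<Longrightarrow> (f has_derivative f' x) (at x)" "\<And>v. Ck_on k S (\<lambda>x. f' x v)"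
  shows "Ck_on (Suc k) S f"
proof -
  have "frechet_derivative f (at x) = f' x" if "x \<in> S" for x
    using frechet_derivative_at[OF assms(2)[OF that]] by simp
  then show ?thesis
    using assms Ck_on_cong[OF \<open>open S\<close>, of "\<lambda>x. frechet_derivative f (at x) _" "\<lambda>x. f' x _"]
    by (auto simp: differentiable_def)
qed

lemma Ck_on_SucD:
  assumes "Ck_on (Suc k) S f" "x \<in> S"
  shows "(f has_derivative frechet_derivative f (at x)) (at x)"
  using assms by (auto simp: frechet_derivative_works)

lemma Ck_on_Suc_imp: "Ck_on (Suc k) S f \<Longrightarrow> Ck_on k S f"
proof (induction k arbitrary: f)
  case 0
  then show ?case
    by (auto intro!: differentiable_imp_continuous_on
        simp: differentiable_on_def differentiable_at_withinI)
next
  case (Suc k)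
  then show ?case by (metis Ck_on.simps(2))
qed

lemma Ck_on_local:
  assumes "\<And>x. x \<in> S \<Longrightarrow> \<exists>U. open U \<and> x \<in> U \<and> Ck_on k (S \<inter> U) f"
  shows "Ck_on k S f"
  using assms
proof (induction k arbitrary: f)
  case 0
  show ?case unfolding Ck_on.simps continuous_on_eq_continuous_within
  proof
    fix x assume "x \<in> S"
    then obtain U where U: "open U" "x \<in> U" "continuous_on (S \<inter> U) f"
      using "0.prems" by auto
    then have "continuous (at x within S \<inter> U) f"
      using \<open>x \<in> S\<close> by (simp add: continuous_on_eq_continuous_within)
    then show "continuous (at x within S) f"
      using U by (simp add: at_within_nhd[of x U S "S \<inter> U"])
  qed
next
  case (Suc k)
  show ?case
  proof (clarsimp, intro conjI ballI allI)
    fix x assume "x \<in> S"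
    then show "f differentiable at x" using Suc.prems by force
  next
    fix v show "Ck_on k S (\<lambda>x. frechet_derivative f (at x) v)"
      by (rule Suc.IH) (use Suc.prems in force)
  qed
qed

lemma Ck_on_const: "open S \<Longrightarrow> Ck_on k S (\<lambda>x. c)"
proof (induction k arbitrary: c)
  case (Suc k)
  show ?case by (rule Ck_on_SucI[where f'="\<lambda>_ _. 0"]) (use Suc in auto)
qed simp

lemma Ck_on_linear:
  assumes "open S" "bounded_linear L" "Ck_on k S f"
  shows "Ck_on k S (\<lambda>x. L (f x))"
  using assms(3)
proof (induction k arbitrary: f)
  case 0
  then show ?case
    using bounded_linear.continuous_on[OF assms(2)] by simp
next
  case (Suc k)
  show ?case
    by (rule Ck_on_SucI[where f'="\<lambda>x v. L (frechet_derivative f (at x) v)", OF \<open>open S\<close>])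
       (use Suc Ck_on_SucD[OF Suc.prems] in \<open>auto intro: bounded_linear.has_derivative[OF assms(2)]\<close>)
qed

lemma Ck_on_id: "open S \<Longrightarrow> Ck_on k S (\<lambda>x. x)"
  by (cases k) (auto intro!: Ck_on_SucI[where f'="\<lambda>_ v. v"] Ck_on_const)

lemma Ck_on_add:
  assumes "open S" "Ck_on k S f" "Ck_on k S g"
  shows "Ck_on k S (\<lambda>x. f x + g x)"
  using assms(2,3)
proof (induction k arbitrary: f g)
  case (Suc k)
  show ?case
    by (rule Ck_on_SucI[where f'="\<lambda>x v. frechet_derivative f (at x) v + frechet_derivative g (at x) v", OF \<open>open S\<close>])
       (use Suc Ck_on_SucD[OF Suc.prems(1)] Ck_on_SucD[OF Suc.prems(2)] in \<open>auto intro: has_derivative_add\<close>)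
qed (auto intro: continuous_intros)

lemma Ck_on_sum:
  assumes "open S" "\<And>i. i \<in> I \<Longrightarrow> Ck_on k S (f i)"
  shows "Ck_on k S (\<lambda>x. \<Sum>i\<in>I. f i x)"
proof (cases "finite I")
  case True
  then show ?thesis using assms(2)
    by (induction I) (auto intro: Ck_on_const[OF \<open>open S\<close>] Ck_on_add[OF \<open>open S\<close>])
qed (simp add: Ck_on_const[OF \<open>open S\<close>])

lemma Ck_on_bilinear:
  assumes "open S" "bounded_bilinear B" "Ck_on k S f" "Ck_on k S g"
  shows "Ck_on k S (\<lambda>x. B (f x) (g x))"
  using assms(3,4)
proof (induction k arbitrary: f g)
  case 0
  then show ?case using bounded_bilinear.continuous_on[OF assms(2)] by auto
next
  case (Suc k)
  show ?case
  proof (rule Ck_on_SucI[OF \<open>open S\<close>])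
    show "((\<lambda>x. B (f x) (g x)) has_derivative
        (\<lambda>v. B (f x) (frechet_derivative g (at x) v) + B (frechet_derivative f (at x) v) (g x))) (at x)"
      if "x \<in> S" for x
      using bounded_bilinear.FDERIV[OF assms(2)] Ck_on_SucD[OF Suc.prems(1) that]
        Ck_on_SucD[OF Suc.prems(2) that] by blast
    show "Ck_on k S (\<lambda>x. B (f x) (frechet_derivative g (at x) v) + B (frechet_derivative f (at x) v) (g x))" for v
      using Suc by (auto intro!: Ck_on_add[OF \<open>open S\<close>] Suc.IH intro: Ck_on_Suc_imp simp del: Ck_on.simps)
        (use Suc.prems in auto)
  qed
qed

text \<open>In the chain rule the inner derivative occurs as the argument of the outer one. Expanding that
  argument in the basis turns the derivative of the composite into a finite sum of products of
  directional derivatives, each of which is covered by the induction hypothesis.\<close>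

lemma Ck_on_compose:
  fixes f :: "'a::euclidean_space \<Rightarrow> 'b::euclidean_space" and g :: "'b \<Rightarrow> 'c::real_normed_vector"
  assumes "open S" "open T" "f ` S \<subseteq> T" "Ck_on k S f" "Ck_on k T g"
  shows "Ck_on k S (\<lambda>x. g (f x))"
  using assms(4,5)
proof (induction k arbitrary: g)
  case 0
  then show ?case using assms(3) by (auto intro: continuous_on_compose2)
next
  case (Suc k)
  let ?f' = "\<lambda>x. frechet_derivative f (at x)" and ?g' = "\<lambda>y. frechet_derivative g (at y)"
  show ?case
  proof (rule Ck_on_SucI[OF \<open>open S\<close>])
    fix x assume x: "x \<in> S"
    have g: "(g has_derivative ?g' (f x)) (at (f x))"
      using Ck_on_SucD[OF Suc.prems(2)] x assms(3) by auto
    have "((\<lambda>x. g (f x)) has_derivative (\<lambda>v. ?g' (f x) (?f' x v))) (at x)"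
      using has_derivative_compose[OF Ck_on_SucD[OF Suc.prems(1) x] g] .
    moreover have "?g' (f x) w = (\<Sum>b\<in>Basis. (w \<bullet> b) *\<^sub>R ?g' (f x) b)" for w
    proof -
      have "?g' (f x) w = ?g' (f x) (\<Sum>b\<in>Basis. (w \<bullet> b) *\<^sub>R b)"
        by (simp add: euclidean_representation)
      also have "\<dots> = (\<Sum>b\<in>Basis. (w \<bullet> b) *\<^sub>R ?g' (f x) b)"
        using has_derivative_linear[OF g] by (simp add: linear_sum linear_scale)
      finally show ?thesis .
    qed
    ultimately show "((\<lambda>x. g (f x)) has_derivative
        (\<lambda>v. \<Sum>b\<in>Basis. (?f' x v \<bullet> b) *\<^sub>R ?g' (f x) b)) (at x)"
      by (metis (no_types, lifting) ext)
  next
    fix v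
    have "Ck_on k S (\<lambda>x. ?g' (f x) b)" for b
      using Suc.IH[of "\<lambda>y. ?g' y b"] Suc.prems Ck_on_Suc_imp by auto
    then show "Ck_on k S (\<lambda>x. \<Sum>b\<in>Basis. (?f' x v \<bullet> b) *\<^sub>R ?g' (f x) b)"
      using Suc.prems(1)
      by (intro Ck_on_sum[OF \<open>open S\<close>] Ck_on_bilinear[OF \<open>open S\<close> bounded_bilinear_scaleR]
          Ck_on_linear[OF \<open>open S\<close> bounded_linear_inner_left]) auto
  qed
qed

lemma Ck_on_inverse: "Ck_on k (- {0::real}) inverse"
proof (induction k)
  case (Suc k)
  have *: "open (- {0::real})" by auto
  show ?case
  proof (rule Ck_on_SucI[OF *])
    show "(inverse has_derivative (\<lambda>v. (inverse x * inverse x) * (- v))) (at x)" if "x \<in> - {0}" for x :: real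
      using has_derivative_inverse'[of x UNIV] that by (auto simp: algebra_simps)
    show "Ck_on k (- {0::real}) (\<lambda>x. (inverse x * inverse x) * (- v))" for v
      by (intro Ck_on_bilinear[OF * bounded_bilinear_mult] Suc Ck_on_const[OF *])
  qed
qed (auto intro: continuous_intros)

lemma has_derivative_ln_abs:
  assumes "x \<noteq> (0::real)"
  shows "((\<lambda>x. ln \<bar>x\<bar>) has_derivative (\<lambda>v. v / x)) (at x)"
proof (cases "x > 0")
  case True
  have "(ln has_derivative (\<lambda>v. v / x)) (at x)"
    by (rule has_derivative_eq_rhs[OF DERIV_ln_divide[OF True, unfolded has_field_derivative_def]]) auto
  then show ?thesis
    by (rule has_derivative_transform_within_open[of _ _ _ _ "{0<..}"]) (use True in auto)
next
  case False
  then have "- x > 0" using assms by auto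
  then have "(ln has_derivative (\<lambda>v. v / (- x))) (at (- x))"
    by (intro has_derivative_eq_rhs[OF DERIV_ln_divide[of "-x", unfolded has_field_derivative_def]]) auto
  from has_derivative_compose[OF has_derivative_minus[OF has_derivative_ident] this]
  have "((\<lambda>x. ln (- x)) has_derivative (\<lambda>v. v / x)) (at x)" by simp
  then show ?thesis
    by (rule has_derivative_transform_within_open[of _ _ _ _ "{..<0}"]) (use \<open>- x > 0\<close> in auto)
qed

lemma Ck_on_ln_abs: "Ck_on k (- {0::real}) (\<lambda>x. ln \<bar>x\<bar>)"
proof (cases k)
  case (Suc k)
  have *: "open (- {0::real})" by auto
  have "Ck_on (Suc k) (- {0::real}) (\<lambda>x. ln \<bar>x\<bar>)"
  proof (rule Ck_on_SucI[OF *])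
    show "((\<lambda>x. ln \<bar>x\<bar>) has_derivative (\<lambda>v. inverse x * v)) (at x)" if "x \<in> - {0}" for x :: real
      using has_derivative_ln_abs[of x] that by (simp add: field_simps)
    show "Ck_on k (- {0::real}) (\<lambda>x. inverse x * v)" for v
      by (intro Ck_on_bilinear[OF * bounded_bilinear_mult] Ck_on_inverse Ck_on_const[OF *])
  qed
  then show ?thesis using Suc by simp
qed (auto intro!: continuous_intros)

lemma smooth_on_subset: "smooth_on S f \<Longrightarrow> T \<subseteq> S \<Longrightarrow> smooth_on T f"
  by (auto simp: smooth_on_def intro: Ck_on_subset)

lemma smooth_on_cong:
  "open S \<Longrightarrow> (\<And>x. x \<in> S \<Longrightarrow> f x = g x) \<Longrightarrow> smooth_on S f \<Longrightarrow> smooth_on S g"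
  unfolding smooth_on_def using Ck_on_cong_imp by blast

lemma smooth_on_local:
  "(\<And>x. x \<in> S \<Longrightarrow> \<exists>U. open U \<and> x \<in> U \<and> smooth_on (S \<inter> U) f) \<Longrightarrow> smooth_on S f"
  unfolding smooth_on_def by (meson Ck_on_local)

lemma smooth_on_has_derivative:
  "smooth_on S f \<Longrightarrow> x \<in> S \<Longrightarrow> (f has_derivative frechet_derivative f (at x)) (at x)"
  unfolding smooth_on_def using Ck_on_SucD by blast

lemma smooth_on_continuous_on: "smooth_on S f \<Longrightarrow> continuous_on S f"
  unfolding smooth_on_def by (metis Ck_on.simps(1))

lemma smooth_on_frechet_derivative:
  "smooth_on S f \<Longrightarrow> smooth_on S (\<lambda>x. frechet_derivative f (at x) v)"
  unfolding smooth_on_def using Ck_on.simps(2) by blast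

lemma smooth_on_const: "open S \<Longrightarrow> smooth_on S (\<lambda>x. c)"
  by (simp add: smooth_on_def Ck_on_const)

lemma smooth_on_id: "open S \<Longrightarrow> smooth_on S (\<lambda>x. x)"
  by (simp add: smooth_on_def Ck_on_id)

lemma smooth_on_linear:
  "open S \<Longrightarrow> bounded_linear L \<Longrightarrow> smooth_on S f \<Longrightarrow> smooth_on S (\<lambda>x. L (f x))"
  by (simp add: smooth_on_def Ck_on_linear)

lemma smooth_on_add:
  "open S \<Longrightarrow> smooth_on S f \<Longrightarrow> smooth_on S g \<Longrightarrow> smooth_on S (\<lambda>x. f x + g x)"
  by (simp add: smooth_on_def Ck_on_add)

lemma smooth_on_bilinear:
  "open S \<Longrightarrow> bounded_bilinear B \<Longrightarrow> smooth_on S f \<Longrightarrow> smooth_on S g \<Longrightarrow> smooth_on S (\<lambda>x. B (f x) (g x))"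
  by (simp add: smooth_on_def Ck_on_bilinear)

lemma smooth_on_mult:
  fixes f g :: "'a::euclidean_space \<Rightarrow> real"
  shows "open S \<Longrightarrow> smooth_on S f \<Longrightarrow> smooth_on S g \<Longrightarrow> smooth_on S (\<lambda>x. f x * g x)"
  by (rule smooth_on_bilinear[OF _ bounded_bilinear_mult])

lemma smooth_on_minus: "open S \<Longrightarrow> smooth_on S f \<Longrightarrow> smooth_on S (\<lambda>x. - f x)"
  by (rule smooth_on_linear[OF _ bounded_linear_minus[OF bounded_linear_ident]])

lemma smooth_on_diff:
  "open S \<Longrightarrow> smooth_on S f \<Longrightarrow> smooth_on S g \<Longrightarrow> smooth_on S (\<lambda>x. f x - g x)"
  using smooth_on_add[of S f "\<lambda>x. - g x"] smooth_on_minus by auto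

lemma smooth_on_compose:
  fixes f :: "'a::euclidean_space \<Rightarrow> 'b::euclidean_space" and g :: "'b \<Rightarrow> 'c::real_normed_vector"
  assumes "open S" "open T" "smooth_on T g" "smooth_on S f" "f ` S \<subseteq> T"
  shows "smooth_on S (\<lambda>x. g (f x))"
  using assms Ck_on_compose[OF assms(1,2,5)] unfolding smooth_on_def by blast

lemma smooth_on_Pair:
  assumes "open S" "smooth_on S f" "smooth_on S g"
  shows "smooth_on S (\<lambda>x. (f x, g x))"
proof -
  have "smooth_on S (\<lambda>x. (f x, 0) + (0, g x))"
    by (intro smooth_on_add smooth_on_linear[OF assms(1), of "\<lambda>y. (y, 0)"]
        smooth_on_linear[OF assms(1), of "\<lambda>y. (0, y)"] assms)
       (auto intro!: bounded_linear_Pair bounded_linear_zero bounded_linear_ident)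
  then show ?thesis by simp
qed

lemma smooth_on_divide:
  fixes f g :: "'a::euclidean_space \<Rightarrow> real"
  assumes "open S" "smooth_on S f" "smooth_on S g" "\<And>x. x \<in> S \<Longrightarrow> g x \<noteq> 0"
  shows "smooth_on S (\<lambda>x. f x / g x)"
proof -
  have "smooth_on S (\<lambda>x. inverse (g x))"
    by (rule smooth_on_compose[where T="- {0}"]) (use assms in \<open>auto simp: smooth_on_def Ck_on_inverse\<close>)
  then show ?thesis
    unfolding divide_inverse using assms by (intro smooth_on_mult)
qed

lemma smooth_on_ln_abs:
  fixes g :: "'a::euclidean_space \<Rightarrow> real"
  assumes "open S" "smooth_on S g" "\<And>x. x \<in> S \<Longrightarrow> g x \<noteq> 0"
  shows "smooth_on S (\<lambda>x. ln \<bar>g x\<bar>)"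
  by (rule smooth_on_compose[where T="- {0}" and g="\<lambda>x. ln \<bar>x\<bar>"])
     (use assms in \<open>auto simp: smooth_on_def Ck_on_ln_abs\<close>)

section \<open>Slice charts, and foliations given by a straightening diffeomorphism\<close>

text \<open>The charts that \<open>embedded_submanifold\<close> provides, bundled with the patch \<open>S\<close> of the manifold topology \<open>T\<close>
  on which they live.\<close>

definition slice_chart ::
    "'a::euclidean_space topology \<Rightarrow> 'a set \<Rightarrow> 'a set \<Rightarrow> ('a \<Rightarrow> 'a) \<Rightarrow> ('a \<Rightarrow> 'a) \<Rightarrow> 'a set \<Rightarrow> bool"
  where "slice_chart T S U \<Phi> \<Psi> H \<longleftrightarrow>
           openin T S \<and> subtopology T S = top_of_set S \<and> open U \<and> open (\<Phi> ` U) \<and>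
           smooth_on U \<Phi> \<and> smooth_on (\<Phi> ` U) \<Psi> \<and> (\<forall>y\<in>U. \<Psi> (\<Phi> y) = y) \<and>
           subspace H \<and> \<Phi> ` (U \<inter> S) = \<Phi> ` U \<inter> H"

lemma second_countable_euclidean: "second_countable (euclidean :: 'a::second_countable_topology topology)"
proof -
  obtain \<B> :: "'a set set" where "countable \<B>" "\<And>C. C \<in> \<B> \<Longrightarrow> open C"
    "\<And>S. open S \<Longrightarrow> \<exists>U. U \<subseteq> \<B> \<and> S = \<Union>U"
    using univ_second_countable by blast
  then show ?thesis
    unfolding second_countable_def by (metis UnionE Union_upper open_openin subsetD)
qed

lemma submanifold_slice_chart:
  assumes "submanifold k T" "x \<in> topspace T"
  obtains S U \<Phi> \<Psi> H where "slice_chart T S U \<Phi> \<Psi> H" "x \<in> U" "x \<in> S"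
  using assms unfolding submanifold_def embedded_submanifold_def slice_chart_def by metis

lemma slice_chart_mem:
  assumes "slice_chart T S U \<Phi> \<Psi> H" "z \<in> \<Phi> ` U" "z \<in> H"
  shows "\<Psi> z \<in> U \<inter> S" "\<Phi> (\<Psi> z) = z"
proof -
  have "z \<in> \<Phi> ` (U \<inter> S)" using assms by (auto simp: slice_chart_def)
  then obtain y where "y \<in> U \<inter> S" "z = \<Phi> y" by blast
  then show "\<Psi> z \<in> U \<inter> S" "\<Phi> (\<Psi> z) = z" using assms(1) by (auto simp: slice_chart_def)
qed

text \<open>A straight line in the model subspace, pulled back by the chart, is a smooth curve in the submanifold.\<close>

lemma slice_chart_tangent:
  assumes "slice_chart T S U \<Phi> \<Psi> H" "z \<in> \<Phi> ` U" "z \<in> H" "h \<in> H"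
  shows "frechet_derivative \<Psi> (at z) h \<in> tangent_space T (\<Psi> z)"
proof -
  note C = assms(1)[unfolded slice_chart_def]
  define l where "l t = z + t *\<^sub>R h" for t :: real
  have l: "continuous_on UNIV l" "smooth_on UNIV l"
    unfolding l_def by (auto intro!: continuous_intros smooth_on_add smooth_on_const
        smooth_on_linear[OF _ bounded_linear_scaleR_left] smooth_on_id)
  have "open (l -` (\<Phi> ` U))"
    using C l(1) by (intro open_vimage) auto
  moreover have "0 \<in> l -` (\<Phi> ` U)" using assms(2) by (simp add: l_def)
  ultimately obtain \<epsilon> where \<epsilon>: "\<epsilon> > 0" "ball 0 \<epsilon> \<subseteq> l -` (\<Phi> ` U)"
    by (meson open_contains_ball)
  have I: "{-\<epsilon><..<\<epsilon>} = ball 0 \<epsilon>" for \<epsilon> :: real by (auto simp: dist_real_def)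
  have lin: "l t \<in> \<Phi> ` U" if "t \<in> {-\<epsilon><..<\<epsilon>}" for t using \<epsilon>(2) that unfolding I by auto
  have lH: "l t \<in> H" for t
    using C assms(3,4) by (auto simp: l_def subspace_add subspace_mul)
  have sm: "smooth_on {-\<epsilon><..<\<epsilon>} (\<lambda>t. \<Psi> (l t))"
    by (rule smooth_on_compose[of _ "\<Phi> ` U"]) (use C l lin in \<open>auto intro: smooth_on_subset\<close>)
  have "continuous_map (top_of_set {-\<epsilon><..<\<epsilon>}) (subtopology T S) (\<lambda>t. \<Psi> (l t))"
    using C smooth_on_continuous_on[OF sm] slice_chart_mem(1)[OF assms(1) lin lH]
    by (auto simp: continuous_map_iff_continuous continuous_map_in_subtopology)
  then have "continuous_map (top_of_set {-\<epsilon><..<\<epsilon>}) T (\<lambda>t. \<Psi> (l t))"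
    by (simp add: continuous_map_in_subtopology)
  moreover have "((\<lambda>t. \<Psi> (l t)) has_vector_derivative frechet_derivative \<Psi> (at z) h) (at 0)"
  proof -
    have "(l has_derivative (\<lambda>t. t *\<^sub>R h)) (at 0)"
      unfolding l_def by (auto intro!: derivative_eq_intros)
    moreover have D: "(\<Psi> has_derivative frechet_derivative \<Psi> (at z)) (at (l 0))"
      using smooth_on_has_derivative[of "\<Phi> ` U" \<Psi> z] C assms(2) by (simp add: l_def)
    ultimately have "((\<lambda>t. \<Psi> (l t)) has_derivative (\<lambda>t. frechet_derivative \<Psi> (at z) (t *\<^sub>R h))) (at 0)"
      by (rule has_derivative_compose)
    then show ?thesis
      using linear_scale[OF has_derivative_linear[OF D]] by (simp add: has_vector_derivative_def)
  qed
  ultimately show ?thesis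
    unfolding tangent_space_def using \<epsilon>(1) sm
    by (intro CollectI exI[of _ \<epsilon>] conjI exI[of _ "\<lambda>t. \<Psi> (l t)"]) (auto simp: l_def)
qed

lemma slice_chart_open:
  assumes "slice_chart T S U \<Phi> \<Psi> H" "open W" "W \<subseteq> \<Phi> ` U"
  shows "openin T (\<Psi> ` (W \<inter> H))"
proof -
  note C = assms(1)[unfolded slice_chart_def]
  have "\<Psi> ` (W \<inter> H) = S \<inter> (U \<inter> \<Phi> -` W)"
  proof (intro equalityI subsetI)
    fix y assume "y \<in> \<Psi> ` (W \<inter> H)"
    then show "y \<in> S \<inter> (U \<inter> \<Phi> -` W)"
      using slice_chart_mem[OF assms(1)] assms(3) by auto
  next
    fix y assume y: "y \<in> S \<inter> (U \<inter> \<Phi> -` W)"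
    then have "\<Phi> y \<in> H" using C by auto
    then show "y \<in> \<Psi> ` (W \<inter> H)" using y C by (intro image_eqI[of _ _ "\<Phi> y"]) auto
  qed
  moreover have "open (U \<inter> \<Phi> -` W)"
    using C smooth_on_continuous_on assms(2) by (intro continuous_open_preimage) auto
  then have "openin (top_of_set S) (S \<inter> (U \<inter> \<Phi> -` W))"
    by (rule openin_open_Int)
  ultimately show ?thesis
    using C by (metis openin_trans_full)
qed

text \<open>The topology of a submanifold may be finer than the subspace topology, but not coarser.\<close>

lemma submanifold_continuous_id:
  assumes "submanifold k T"
  shows "continuous_map T euclidean (\<lambda>x. x)"
  unfolding continuous_map_def
proof (intro conjI allI impI)
  fix W :: "'a set" assume "openin euclidean W"
  then have W: "open W" by simp
  show "openin T {x \<in> topspace T. x \<in> W}"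
  proof (subst openin_subopen, intro ballI)
    fix x assume x: "x \<in> {x \<in> topspace T. x \<in> W}"
    then obtain S where S: "openin T S" "x \<in> S" "subtopology T S = top_of_set S"
      using assms unfolding submanifold_def by blast
    have "openin (subtopology T S) (S \<inter> W)"
      using S(3) W by (simp add: openin_open_Int)
    then have "openin T (S \<inter> W)" using S(1) by (rule openin_trans_full)
    then show "\<exists>N. openin T N \<and> x \<in> N \<and> N \<subseteq> {x \<in> topspace T. x \<in> W}"
      using S x openin_subset by blast
  qed
qed auto

lemma submanifold_openin_Int:
  assumes "submanifold k T" "open W"
  shows "openin T (topspace T \<inter> W)"
  using openin_continuous_map_preimage[OF submanifold_continuous_id[OF assms(1)], of W] assms(2)
  by (simp add: Int_def)

lemma connected_space_locally_constant:
  assumes "connected_space T" "x \<in> topspace T" "y \<in> topspace T"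
    and "\<And>u. u \<in> topspace T \<Longrightarrow> \<exists>N. openin T N \<and> u \<in> N \<and> (\<forall>v\<in>N. h v = h u)"
  shows "h x = h y"
proof -
  let ?A = "{u \<in> topspace T. h u = h x}"
  have op: "openin T {u \<in> topspace T. P (h u)}" for P
  proof (subst openin_subopen, intro ballI)
    fix u assume u: "u \<in> {u \<in> topspace T. P (h u)}"
    then obtain N where "openin T N" "u \<in> N" "\<forall>v\<in>N. h v = h u" using assms(4) by blast
    then show "\<exists>N. openin T N \<and> u \<in> N \<and> N \<subseteq> {u \<in> topspace T. P (h u)}"
      using u openin_subset[of T N] by (metis (mono_tags, lifting) mem_Collect_eq subset_iff)
  qed
  have "openin T ?A" by (rule op)
  moreover have "topspace T - ?A = {u \<in> topspace T. h u \<noteq> h x}" by auto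
  then have "closedin T ?A" using op[of "\<lambda>c. c \<noteq> h x"] by (auto simp: closedin_def)
  ultimately have "?A = {} \<or> ?A = topspace T"
    using assms(1) unfolding connected_space_clopen_in by blast
  then have "y \<in> ?A" using assms(2,3) by blast
  then show ?thesis by simp
qed

text \<open>The diffeomorphism \<open>\<Phi>\<close> flattens the leaves: it carries them into hyperplanes orthogonal to \<open>b\<close>. One level
  set of \<open>\<lambda>x. \<Phi> x \<bullet> b\<close> may consist of several leaves; the locally constant labelling \<open>\<kappa>\<close> tells them apart.\<close>

locale straightened_foliation =
  fixes V V' :: "'a::euclidean_space set" and \<Phi> \<Psi> :: "'a \<Rightarrow> 'a" and b :: 'a and \<kappa> :: "'a \<Rightarrow> 'k"
  assumes open_V: "open V" and open_V': "open V'"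
    and smooth_\<Phi>: "smooth_on V \<Phi>" and smooth_\<Psi>: "smooth_on V' \<Psi>"
    and \<Phi>_in: "x \<in> V \<Longrightarrow> \<Phi> x \<in> V'" and \<Psi>_in: "z \<in> V' \<Longrightarrow> \<Psi> z \<in> V"
    and \<Psi>_\<Phi>: "x \<in> V \<Longrightarrow> \<Psi> (\<Phi> x) = x" and \<Phi>_\<Psi>: "z \<in> V' \<Longrightarrow> \<Phi> (\<Psi> z) = z"
    and b_Basis: "b \<in> Basis"
    and open_piece: "open {x \<in> V. \<kappa> x = k}"
    and connected_piece: "connected {x \<in> V. \<kappa> x = k \<and> \<Phi> x \<bullet> b = c}"
begin

abbreviation d\<Phi> :: "'a \<Rightarrow> 'a \<Rightarrow> 'a" where "d\<Phi> x \<equiv> frechet_derivative \<Phi> (at x)"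
abbreviation d\<Psi> :: "'a \<Rightarrow> 'a \<Rightarrow> 'a" where "d\<Psi> z \<equiv> frechet_derivative \<Psi> (at z)"

definition leaf :: "'a \<Rightarrow> 'a set"
  where "leaf x = {y \<in> V. \<kappa> y = \<kappa> x \<and> \<Phi> y \<bullet> b = \<Phi> x \<bullet> b}"

definition D :: "'a \<Rightarrow> 'a set"
  where "D x = {v. d\<Phi> x v \<bullet> b = 0}"

abbreviation H :: "'a set" where "H \<equiv> {w. w \<bullet> b = 0}"

lemma \<Phi>_deriv: "x \<in> V \<Longrightarrow> (\<Phi> has_derivative d\<Phi> x) (at x)"
  using smooth_\<Phi> smooth_on_has_derivative by blast

lemma \<Psi>_deriv: "z \<in> V' \<Longrightarrow> (\<Psi> has_derivative d\<Psi> z) (at z)"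
  using smooth_\<Psi> smooth_on_has_derivative by blast

lemma d\<Psi>_d\<Phi>: assumes "x \<in> V" shows "d\<Psi> (\<Phi> x) (d\<Phi> x v) = v"
proof -
  have "((\<lambda>x. \<Psi> (\<Phi> x)) has_derivative (\<lambda>v. d\<Psi> (\<Phi> x) (d\<Phi> x v))) (at x)"
    using has_derivative_compose[OF \<Phi>_deriv \<Psi>_deriv] \<Phi>_in assms by blast
  then have "((\<lambda>x. x) has_derivative (\<lambda>v. d\<Psi> (\<Phi> x) (d\<Phi> x v))) (at x)"
    by (rule has_derivative_transform_within_open[OF _ open_V]) (use assms \<Psi>_\<Phi> in auto)
  from has_derivative_unique[OF this has_derivative_ident] show ?thesis by (rule fun_cong)
qed

lemma d\<Phi>_d\<Psi>: assumes "x \<in> V" shows "d\<Phi> x (d\<Psi> (\<Phi> x) w) = w"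
proof -
  have "((\<lambda>z. \<Phi> (\<Psi> z)) has_derivative (\<lambda>v. d\<Phi> (\<Psi> (\<Phi> x)) (d\<Psi> (\<Phi> x) v))) (at (\<Phi> x))"
    using has_derivative_compose[OF \<Psi>_deriv \<Phi>_deriv] \<Phi>_in \<Psi>_in assms by blast
  then have "((\<lambda>z. z) has_derivative (\<lambda>v. d\<Phi> x (d\<Psi> (\<Phi> x) v))) (at (\<Phi> x))"
    unfolding \<Psi>_\<Phi>[OF assms]
    by (rule has_derivative_transform_within_open[OF _ open_V']) (use assms \<Phi>_in \<Phi>_\<Psi> in auto)
  from has_derivative_unique[OF this has_derivative_ident] show ?thesis by (rule fun_cong)
qed

lemma D_eq: assumes "x \<in> V" shows "D x = d\<Psi> (\<Phi> x) ` H"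
proof (intro equalityI subsetI)
  fix v assume "v \<in> D x"
  then show "v \<in> d\<Psi> (\<Phi> x) ` H"
    using d\<Psi>_d\<Phi>[OF assms] by (intro image_eqI[of _ _ "d\<Phi> x v"]) (auto simp: D_def)
qed (auto simp: D_def d\<Phi>_d\<Psi> assms)

lemma H_eq_span: "H = span (Basis - {b})"
proof -
  have *: "w = (\<Sum>i\<in>Basis - {b}. (w \<bullet> i) *\<^sub>R i)" if "w \<bullet> b = 0" for w
  proof -
    have "w = (\<Sum>i\<in>Basis. (w \<bullet> i) *\<^sub>R i)" by (simp add: euclidean_representation)
    also have "\<dots> = (\<Sum>i\<in>Basis - {b}. (w \<bullet> i) *\<^sub>R i)"
      using that by (simp add: sum.remove[OF _ b_Basis])
    finally show ?thesis .
  qed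
  have "w \<in> span (Basis - {b})" if "w \<bullet> b = 0" for w
    by (subst *[OF that], intro span_sum span_scale span_base)
  moreover have "span (Basis - {b}) \<subseteq> H"
    by (rule span_minimal) (use b_Basis in \<open>auto simp: inner_not_same_Basis subspace_hyperplane2 inner_commute[of _ b] subspace_hyperplane\<close>)
  ultimately show ?thesis by auto
qed

lemma subspace_H: "subspace H"
  unfolding H_eq_span by simp

lemma dim_H: "dim H = DIM('a) - 1"
proof -
  have "independent (Basis - {b})"
    by (rule independent_mono[OF independent_Basis]) auto
  then show ?thesis
    unfolding H_eq_span using b_Basis by (simp add: dim_eq_card_independent)
qed

lemma smooth_subbundle_D: "smooth_subbundle V (DIM('a) - 1) D"
  unfolding smooth_subbundle_def
proof (intro conjI ballI)
  fix x assume x: "x \<in> V"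
  have lin: "linear (d\<Psi> (\<Phi> x))" if "x \<in> V" for x
    using \<Psi>_deriv[OF \<Phi>_in[OF that]] by (rule has_derivative_linear)
  show "subspace (D x)"
    unfolding D_eq[OF x] by (rule linear_subspace_image[OF lin[OF x] subspace_H])
  have "inj (d\<Psi> (\<Phi> x))"
    by (rule inj_on_inverseI[of _ "d\<Phi> x"]) (simp add: d\<Phi>_d\<Psi> x)
  then show "dim (D x) = DIM('a) - 1"
    unfolding D_eq[OF x] using dim_image_eq[OF lin[OF x], of H] dim_H inj_on_subset by fastforce
  have "card (Basis - {b}) = DIM('a) - 1" using b_Basis by simp
  then obtain h where h: "bij_betw h {..<DIM('a) - 1} (Basis - {b})"
    using ex_bij_betw_nat_finite[of "Basis - {b}"] by (auto simp: atLeast0LessThan)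
  define s where "s i y = d\<Psi> (\<Phi> y) (h i)" for i y
  have "smooth_on V (s i)" for i
    unfolding s_def
    by (rule smooth_on_compose[OF open_V open_V' smooth_on_frechet_derivative[OF smooth_\<Psi>] smooth_\<Phi>])
       (use \<Phi>_in in auto)
  moreover have "D y = span {s i y | i. i < DIM('a) - 1}" if "y \<in> V" for y
  proof -
    have "{s i y | i. i < DIM('a) - 1} = d\<Psi> (\<Phi> y) ` (h ` {..<DIM('a) - 1})"
      by (auto simp: s_def)
    also have "h ` {..<DIM('a) - 1} = Basis - {b}"
      using h by (simp add: bij_betw_def)
    finally show ?thesis
      unfolding D_eq[OF that] H_eq_span by (simp add: linear_span_image[OF lin[OF that]])
  qed
  ultimately show "\<exists>U s. open U \<and> x \<in> U \<and> U \<subseteq> V \<and> (\<forall>i<DIM('a) - 1. smooth_on U (s i)) \<and>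
      (\<forall>y\<in>U. D y = span {s i y | i. i < DIM('a) - 1})"
    using x open_V by (intro exI[of _ V] exI[of _ s]) auto
qed

lemma leaf_refl: "x \<in> V \<Longrightarrow> x \<in> leaf x"
  by (simp add: leaf_def)

lemma leaf_eq: "y \<in> leaf x \<Longrightarrow> leaf y = leaf x"
  by (auto simp: leaf_def)

lemma leaf_subset: "leaf x \<subseteq> V"
  by (auto simp: leaf_def)

text \<open>The diffeomorphism, shifted so that the height of the leaf becomes 0, is a slice chart for the whole leaf.\<close>

lemma leaf_slice_chart:
  defines "c x \<equiv> (\<Phi> x \<bullet> b) *\<^sub>R b"
  shows "slice_chart (top_of_set (leaf x)) (leaf x) {y \<in> V. \<kappa> y = \<kappa> x}
           (\<lambda>y. \<Phi> y - c x) (\<lambda>z. \<Psi> (z + c x)) H"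
proof -
  let ?U = "{y \<in> V. \<kappa> y = \<kappa> x}" let ?\<Phi> = "\<lambda>y. \<Phi> y - c x" let ?\<Psi> = "\<lambda>z. \<Psi> (z + c x)"
  have "?\<Phi> ` ?U = {z. z + c x \<in> V' \<inter> \<Psi> -` ?U}"
  proof (intro equalityI subsetI)
    fix z assume "z \<in> {z. z + c x \<in> V' \<inter> \<Psi> -` ?U}"
    then show "z \<in> ?\<Phi> ` ?U"
      using \<Phi>_\<Psi> by (intro image_eqI[of _ _ "\<Psi> (z + c x)"]) auto
  qed (use \<Phi>_in \<Psi>_\<Phi> in auto)
  moreover have "open (V' \<inter> \<Psi> -` ?U)"
    using smooth_on_continuous_on[OF smooth_\<Psi>] open_V' open_piece by (intro continuous_open_preimage) auto
  then have "open ((\<lambda>z. z + c x) -` (V' \<inter> \<Psi> -` ?U))"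
    by (rule open_vimage) (auto intro: continuous_intros)
  ultimately have 1: "open (?\<Phi> ` ?U)" by (simp add: vimage_def)
  have 2: "smooth_on ?U ?\<Phi>"
    by (intro smooth_on_diff smooth_on_const open_piece smooth_on_subset[OF smooth_\<Phi>]) auto
  have 3: "smooth_on (?\<Phi> ` ?U) ?\<Psi>"
    by (rule smooth_on_compose[OF 1 open_V' smooth_\<Psi>])
       (use \<Phi>_in in \<open>auto intro!: smooth_on_add smooth_on_id smooth_on_const 1\<close>)
  have 4: "?\<Phi> ` (?U \<inter> leaf x) = ?\<Phi> ` ?U \<inter> H"
    using b_Basis by (auto simp: leaf_def c_def inner_diff_left)
  show ?thesis
    unfolding slice_chart_def using 1 2 3 4 open_piece subspace_H \<Psi>_\<Phi> by (auto simp: subtopology_subtopology)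
qed

text \<open>A curve in the leaf has constant height, so its velocity lies in the kernel \<open>D\<close>; conversely every vector of
  \<open>D\<close> is the velocity of a straight line seen through the slice chart.\<close>

lemma leaf_tangent_space:
  assumes "y \<in> leaf x"
  shows "tangent_space (top_of_set (leaf x)) y = D y"
proof (intro equalityI subsetI)
  have y: "y \<in> V" using assms leaf_subset by auto
  fix v assume "v \<in> tangent_space (top_of_set (leaf x)) y"
  then obtain \<epsilon> \<gamma> where \<gamma>: "\<epsilon> > 0" "\<gamma> 0 = y" "continuous_map (top_of_set {-\<epsilon><..<\<epsilon>}) (top_of_set (leaf x)) \<gamma>"
      "(\<gamma> has_vector_derivative v) (at 0)"
    unfolding tangent_space_def by blast
  have "((\<lambda>t. \<Phi> (\<gamma> t)) has_derivative (\<lambda>t. d\<Phi> y (t *\<^sub>R v))) (at 0)"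
    using has_derivative_compose[OF \<gamma>(4)[unfolded has_vector_derivative_def], of \<Phi> "d\<Phi> y"]
      \<Phi>_deriv[OF y] \<gamma>(2) by simp
  then have "((\<lambda>t. \<Phi> (\<gamma> t) \<bullet> b) has_derivative (\<lambda>t. d\<Phi> y (t *\<^sub>R v) \<bullet> b)) (at 0)"
    by (rule has_derivative_inner_left)
  then have "((\<lambda>t. \<Phi> x \<bullet> b) has_derivative (\<lambda>t. d\<Phi> y (t *\<^sub>R v) \<bullet> b)) (at 0)"
    by (rule has_derivative_transform_within_open[of _ _ _ _ "{-\<epsilon><..<\<epsilon>}"])
       (use \<gamma> in \<open>auto simp: leaf_def image_subset_iff continuous_map_in_subtopology\<close>)
  then have "(\<lambda>t. d\<Phi> y (t *\<^sub>R v) \<bullet> b) = (\<lambda>t. 0)"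
    using has_derivative_unique[OF _ has_derivative_const] by blast
  from fun_cong[OF this, of 1] show "v \<in> D y" by (simp add: D_def)
next
  fix v assume "v \<in> D y"
  define c where "c = (\<Phi> x \<bullet> b) *\<^sub>R b"
  have y: "y \<in> V" "\<kappa> y = \<kappa> x" "\<Phi> y \<bullet> b = \<Phi> x \<bullet> b" using assms by (auto simp: leaf_def)
  have z: "\<Phi> y - c \<in> (\<lambda>y. \<Phi> y - c) ` {y \<in> V. \<kappa> y = \<kappa> x}" "\<Phi> y - c \<in> H"
    using y b_Basis by (auto simp: c_def inner_diff_left)
  have "((\<lambda>z. \<Psi> (z + c)) has_derivative d\<Psi> (\<Phi> y)) (at (\<Phi> y - c))"
    by (rule has_derivative_compose[of "\<lambda>z. z + c" "\<lambda>z. z", simplified])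
       (use \<Psi>_deriv[OF \<Phi>_in[OF y(1)]] in \<open>auto intro!: derivative_eq_intros\<close>)
  then have "frechet_derivative (\<lambda>z. \<Psi> (z + c)) (at (\<Phi> y - c)) = d\<Psi> (\<Phi> y)"
    using frechet_derivative_at by metis
  then have "d\<Psi> (\<Phi> y) (d\<Phi> y v) \<in> tangent_space (top_of_set (leaf x)) (\<Psi> (\<Phi> y - c + c))"
    using slice_chart_tangent[OF leaf_slice_chart[of x, folded c_def] z, of "d\<Phi> y v"] \<open>v \<in> D y\<close>
    by (simp add: D_def)
  then show "v \<in> tangent_space (top_of_set (leaf x)) y"
    using d\<Psi>_d\<Phi>[OF y(1)] \<Psi>_\<Phi>[OF y(1)] by simp
qed

lemma leaf_integral_submanifold:
  "integral_submanifold V (DIM('a) - 1) D (top_of_set (leaf x))"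
proof -
  note C = leaf_slice_chart[of x, unfolded slice_chart_def]
  have "embedded_submanifold (DIM('a) - 1) (leaf x)"
    unfolding embedded_submanifold_def
  proof
    fix y assume "y \<in> leaf x"
    then have "y \<in> {y \<in> V. \<kappa> y = \<kappa> x}" by (auto simp: leaf_def)
    then show "\<exists>U \<Phi> \<Psi> H. open U \<and> y \<in> U \<and> open (\<Phi> ` U) \<and> smooth_on U (\<Phi> :: 'a \<Rightarrow> 'a) \<and>
        smooth_on (\<Phi> ` U) (\<Psi> :: 'a \<Rightarrow> 'a) \<and> (\<forall>y\<in>U. \<Psi> (\<Phi> y) = y) \<and> subspace H \<and>
        dim H = DIM('a) - 1 \<and> \<Phi> ` (U \<inter> leaf x) = \<Phi> ` U \<inter> H"
      using C dim_H by blast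
  qed
  then have "submanifold (DIM('a) - 1) (top_of_set (leaf x))"
    unfolding submanifold_def
    by (auto intro!: exI[of _ "leaf x"] second_countable_subtopology second_countable_euclidean
        simp: subtopology_subtopology)
  then show ?thesis
    unfolding integral_submanifold_def using leaf_tangent_space leaf_subset by auto
qed

lemma foliation_D: "foliation V (DIM('a) - 1) D"
  unfolding foliation_def
  using open_V smooth_subbundle_D leaf_integral_submanifold leaf_refl by fastforce

lemma connected_leaf: "connected_space (top_of_set (leaf x))"
  unfolding leaf_def using connected_piece by (simp add: connected_space_subtopology)

text \<open>Along a line in a slice chart of the integral submanifold the height has derivative 0, because the
  velocity lies in \<open>D\<close>. So height and label are locally constant for the topology of the submanifold,
  however its pieces are embedded, and connectedness makes them constant.\<close>

lemma integral_submanifold_in_leaf: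
  assumes T: "integral_submanifold V (DIM('a) - 1) D T" and conn: "connected_space T"
    and x: "x \<in> topspace T"
  shows "topspace T \<subseteq> leaf x"
proof
  fix y assume y: "y \<in> topspace T"
  have sub: "submanifold (DIM('a) - 1) T" and TV: "topspace T \<subseteq> V"
    and tan: "\<And>u. u \<in> topspace T \<Longrightarrow> tangent_space T u = D u"
    using T by (auto simp: integral_submanifold_def)
  have "(\<kappa> x, \<Phi> x \<bullet> b) = (\<kappa> y, \<Phi> y \<bullet> b)"
  proof (rule connected_space_locally_constant[OF conn x y, where h="\<lambda>u. (\<kappa> u, \<Phi> u \<bullet> b)"])
    fix u assume u: "u \<in> topspace T"
    obtain S U \<Phi>' \<Psi>' H' where C': "slice_chart T S U \<Phi>' \<Psi>' H'" and uU: "u \<in> U" "u \<in> S"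
      using submanifold_slice_chart[OF sub u] .
    note C = C'[unfolded slice_chart_def]
    define z where "z = \<Phi>' u"
    have z: "z \<in> \<Phi>' ` U" "z \<in> H'" "\<Psi>' z = u" using C uU by (auto simp: z_def)
    obtain r where r: "r > 0" "ball z r \<subseteq> \<Phi>' ` U"
      using C z(1) open_contains_ball by meson
    have const: "\<Phi> (\<Psi>' w) \<bullet> b = \<Phi> u \<bullet> b" if w: "w \<in> ball z r" "w \<in> H'" for w
    proof -
      define l where "l t = z + t *\<^sub>R (w - z)" for t :: real
      have dz: "w - z \<in> H'" using w(2) z(2) C subspace_diff by blast
      have lH: "l t \<in> H'" for t
        using dz z(2) C by (auto simp: l_def subspace_add subspace_mul)
      have lB: "l t \<in> \<Phi>' ` U" if "t \<in> {0..1}" for t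
      proof -
        have "l t = (1 - t) *\<^sub>R z + t *\<^sub>R w" by (simp add: l_def algebra_simps)
        then have "l t \<in> ball z r"
          using convexD_alt[OF convex_ball[of z r], of z w t] that r(1) w(1) by simp
        then show ?thesis using r(2) by auto
      qed
      have "((\<lambda>t. \<Phi> (\<Psi>' (l t)) \<bullet> b) has_derivative (\<lambda>_. 0)) (at t within {0..1})" if t: "t \<in> {0..1}" for t
      proof -
        have m: "\<Psi>' (l t) \<in> topspace T"
          using slice_chart_mem(1)[OF C' lB[OF t] lH] C openin_subset by blast
        have 1: "(l has_derivative (\<lambda>s. s *\<^sub>R (w - z))) (at t)"
          unfolding l_def by (auto intro!: derivative_eq_intros)
        have 2: "(\<Psi>' has_derivative frechet_derivative \<Psi>' (at (l t))) (at (l t))"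
          using C lB[OF t] smooth_on_has_derivative by blast
        have "frechet_derivative \<Psi>' (at (l t)) (s *\<^sub>R (w - z)) \<in> D (\<Psi>' (l t))" for s
          using slice_chart_tangent[OF C' lB[OF t] lH, of "s *\<^sub>R (w - z)"] dz C tan[OF m]
          by (auto simp: subspace_mul)
        then have 3: "d\<Phi> (\<Psi>' (l t)) (frechet_derivative \<Psi>' (at (l t)) (s *\<^sub>R (w - z))) \<bullet> b = 0" for s
          by (simp add: D_def)
        have "((\<lambda>t. \<Phi> (\<Psi>' (l t)) \<bullet> b) has_derivative
            (\<lambda>s. d\<Phi> (\<Psi>' (l t)) (frechet_derivative \<Psi>' (at (l t)) (s *\<^sub>R (w - z))) \<bullet> b)) (at t)"
          using m TV by (intro has_derivative_inner_left has_derivative_compose[OF has_derivative_compose[OF 1 2]] \<Phi>_deriv) auto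
        then show ?thesis unfolding 3 by (rule has_derivative_at_withinI)
      qed
      then obtain k where "\<And>t. t \<in> {0..1} \<Longrightarrow> \<Phi> (\<Psi>' (l t)) \<bullet> b = k"
        using has_derivative_zero_constant[of "{0..1}" "\<lambda>t. \<Phi> (\<Psi>' (l t)) \<bullet> b"] by auto
      from this[of 0] this[of 1] show ?thesis using z(3) by (simp add: l_def)
    qed
    let ?N = "\<Psi>' ` (ball z r \<inter> H') \<inter> (topspace T \<inter> {y \<in> V. \<kappa> y = \<kappa> u})"
    have "openin T ?N"
      by (intro openin_Int slice_chart_open[OF C' open_ball r(2)] submanifold_openin_Int[OF sub open_piece])
    moreover have "u \<in> ?N"
      using z r(1) u TV by (auto intro!: image_eqI[of _ _ z])
    moreover have "\<forall>v\<in>?N. (\<kappa> v, \<Phi> v \<bullet> b) = (\<kappa> u, \<Phi> u \<bullet> b)"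
    proof
      fix v assume v: "v \<in> ?N"
      then have "\<Phi> v \<bullet> b = \<Phi> u \<bullet> b" using const by blast
      moreover have "\<kappa> v = \<kappa> u" using v by blast
      ultimately show "(\<kappa> v, \<Phi> v \<bullet> b) = (\<kappa> u, \<Phi> u \<bullet> b)" by blast
    qed
    ultimately show "\<exists>N. openin T N \<and> u \<in> N \<and> (\<forall>v\<in>N. (\<kappa> v, \<Phi> v \<bullet> b) = (\<kappa> u, \<Phi> u \<bullet> b))"
      by blast
  qed
  then show "y \<in> leaf x" using y TV by (auto simp: leaf_def)
qed

lemma leaves_eq: "leaves V (DIM('a) - 1) D = leaf ` V"
proof (intro equalityI subsetI)
  fix L assume "L \<in> leaves V (DIM('a) - 1) D"
  then obtain T x where T: "integral_submanifold V (DIM('a) - 1) D T" "connected_space T" "topspace T = L"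
    and x: "x \<in> L"
    and max: "\<And>T. integral_submanifold V (DIM('a) - 1) D T \<Longrightarrow> connected_space T \<Longrightarrow> L \<subseteq> topspace T \<Longrightarrow> topspace T = L"
    unfolding leaves_def by blast
  have "L \<subseteq> leaf x" using integral_submanifold_in_leaf[OF T(1,2)] x T(3) by auto
  then have "leaf x = L"
    using max[OF leaf_integral_submanifold connected_leaf] by auto
  then show "L \<in> leaf ` V" using \<open>L \<subseteq> leaf x\<close> x leaf_subset by blast
next
  fix L assume "L \<in> leaf ` V"
  then obtain x where x: "x \<in> V" "L = leaf x" by auto
  have "topspace T = L" if "integral_submanifold V (DIM('a) - 1) D T" "connected_space T" "L \<subseteq> topspace T" for T
    using integral_submanifold_in_leaf[OF that(1,2), of x] that(3) x leaf_refl by auto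
  then show "L \<in> leaves V (DIM('a) - 1) D"
    unfolding leaves_def using x leaf_refl leaf_integral_submanifold[of x] connected_leaf[of x] by auto
qed

end

section \<open>The transverse measure that counts points on one leaf\<close>

context straightened_foliation
begin

text \<open>In a slice chart of the transversal the height has a derivative that is injective on the model subspace,
  since tangent vectors of the transversal that lie in \<open>D\<close> vanish. A function with injective derivative
  takes its value at a point only once nearby.\<close>

lemma transversal_meets_leaf_isolated:
  assumes N: "transversal V D N" and x: "x \<in> topspace N"
  shows "\<exists>W. openin N W \<and> x \<in> W \<and> W \<inter> leaf x \<subseteq> {x}"
proof -
  obtain m where sub: "submanifold m N" using N by (auto simp: transversal_def)
  have xV: "x \<in> V" and int0: "tangent_space N x \<inter> D x = {0}"
    using N x by (auto simp: transversal_def)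
  obtain S U \<Phi>' \<Psi>' H' where C': "slice_chart N S U \<Phi>' \<Psi>' H'" and xU: "x \<in> U" "x \<in> S"
    using submanifold_slice_chart[OF sub x] .
  note C = C'[unfolded slice_chart_def]
  define z where "z = \<Phi>' x"
  have z: "z \<in> \<Phi>' ` U" "z \<in> H'" "\<Psi>' z = x" using C xU by (auto simp: z_def)
  let ?d\<Psi>' = "frechet_derivative \<Psi>' (at z)" and ?d\<Phi>' = "frechet_derivative \<Phi>' (at x)"
  have d\<Psi>': "(\<Psi>' has_derivative ?d\<Psi>') (at z)"
    using C z smooth_on_has_derivative by blast
  have d\<Phi>': "(\<Phi>' has_derivative ?d\<Phi>') (at x)"
    using C xU smooth_on_has_derivative by blast
  define g where "g w = \<Phi> (\<Psi>' w) \<bullet> b" for w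
  define g' where "g' h = d\<Phi> x (?d\<Psi>' h) \<bullet> b" for h
  have g': "(g has_derivative g') (at z)"
    unfolding g_def g'_def
    using has_derivative_inner_left[OF has_derivative_compose[OF d\<Psi>', of \<Phi> "d\<Phi> x"]] \<Phi>_deriv[OF xV] z(3) by auto
  have "h = 0" if "h \<in> H'" "g' h = 0" for h
  proof -
    have "?d\<Psi>' h \<in> tangent_space N x"
      using slice_chart_tangent[OF C' z(1,2) that(1)] z(3) by simp
    moreover have "?d\<Psi>' h \<in> D x" using that(2) by (simp add: g'_def D_def)
    ultimately have "?d\<Psi>' h = 0" using int0 by blast
    moreover have "((\<lambda>w. w) has_derivative (\<lambda>h. ?d\<Phi>' (?d\<Psi>' h))) (at z)"
    proof (rule has_derivative_transform_within_open)
      show "((\<lambda>w. \<Phi>' (\<Psi>' w)) has_derivative (\<lambda>h. ?d\<Phi>' (?d\<Psi>' h))) (at z)"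
        using has_derivative_compose[OF d\<Psi>', of \<Phi>' ?d\<Phi>'] d\<Phi>' z(3) by simp
    qed (use C z(1) in auto)
    from fun_cong[OF has_derivative_unique[OF this has_derivative_ident]]
    have "?d\<Phi>' (?d\<Psi>' h) = h" .
    ultimately show ?thesis
      using linear_0[OF has_derivative_linear[OF d\<Phi>']] by simp
  qed
  then obtain e where e: "e > 0" "\<And>h. h \<in> H' \<Longrightarrow> norm (g' h) \<ge> e * norm h"
  proof -
    have "subspace H'" using C by blast
    then have "\<exists>e>0. \<forall>h\<in>H'. e * norm h \<le> norm (g' h)"
      using \<open>\<And>h. h \<in> H' \<Longrightarrow> g' h = 0 \<Longrightarrow> h = 0\<close>
      by (intro injective_imp_isometric closed_subspace has_derivative_bounded_linear[OF g']) auto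
    then show ?thesis using that by blast
  qed
  \<comment> \<open>With an error of at most half the lower bound \<open>e\<close>, a nonzero displacement in \<open>H'\<close> changes \<open>g\<close>.\<close>
  obtain d where d: "d > 0" "\<And>w. norm (w - z) < d \<Longrightarrow> norm (g w - g z - g' (w - z)) \<le> e / 2 * norm (w - z)"
  proof -
    have "\<forall>e>0. \<exists>d>0. \<forall>w. norm (w - z) < d \<longrightarrow> norm (g w - g z - g' (w - z)) \<le> e * norm (w - z)"
      using g' unfolding has_derivative_at_alt by (rule conjunct2)
    moreover have "e / 2 > 0" using e(1) by simp
    ultimately have "\<exists>d>0. \<forall>w. norm (w - z) < d \<longrightarrow> norm (g w - g z - g' (w - z)) \<le> e / 2 * norm (w - z)"
      by blast
    then show ?thesis using that by blast
  qed
  obtain r where r: "r > 0" "ball z r \<subseteq> \<Phi>' ` U"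
    using C z(1) open_contains_ball by meson
  define B where "B = ball z (min d r)"
  have B: "open B" "B \<subseteq> \<Phi>' ` U" "z \<in> B" using r d(1) by (auto simp: B_def)
  have "\<Psi>' ` (B \<inter> H') \<inter> leaf x \<subseteq> {x}"
  proof
    fix y assume "y \<in> \<Psi>' ` (B \<inter> H') \<inter> leaf x"
    then obtain w where w: "w \<in> B" "w \<in> H'" "y = \<Psi>' w" "g w = g z"
      using z(3) by (auto simp: g_def leaf_def)
    have "norm (w - z) < d" using w(1) by (simp add: B_def dist_norm norm_minus_commute)
    from d(2)[OF this] have "norm (g' (w - z)) \<le> e / 2 * norm (w - z)" using w(4) by simp
    moreover have "norm (g' (w - z)) \<ge> e * norm (w - z)"
      using e(2) w(2) z(2) C subspace_diff by blast
    ultimately have "e * norm (w - z) \<le> e / 2 * norm (w - z)" by linarith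
    then have "norm (w - z) \<le> 0" using e(1) by (simp add: field_simps)
    then show "y \<in> {x}" using w z(3) by simp
  qed
  moreover have "openin N (\<Psi>' ` (B \<inter> H'))" by (rule slice_chart_open[OF C' B(1,2)])
  moreover have "x \<in> \<Psi>' ` (B \<inter> H')" using z B(3) by (auto intro!: image_eqI[of _ _ z])
  ultimately show ?thesis by blast
qed

lemma open_off_leaf: "open (V - leaf x)"
proof -
  have "V - leaf x = (\<Union>k\<in>- {\<kappa> x}. {y \<in> V. \<kappa> y = k}) \<union> (V \<inter> \<Phi> -` {w. w \<bullet> b \<noteq> \<Phi> x \<bullet> b})"
    by (auto simp: leaf_def)
  moreover have "open {w. w \<bullet> b \<noteq> \<Phi> x \<bullet> b}"
    by (intro open_Collect_neq continuous_intros)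
  then have "open (V \<inter> \<Phi> -` {w. w \<bullet> b \<noteq> \<Phi> x \<bullet> b})"
    by (rule continuous_open_preimage[OF smooth_on_continuous_on[OF smooth_\<Phi>] open_V])
  ultimately show ?thesis using open_piece by (auto intro!: open_Un open_UN)
qed

text \<open>Cover the compact set by open subsets of the transversal that meet the leaf in at most one point: isolating
  neighbourhoods of the points of the leaf, and the complement of the leaf, which is open since leaves are
  closed in \<open>V\<close>.\<close>

lemma finite_compact_transversal_Int_leaf:
  assumes N: "transversal V D N" and K: "compactin N K"
  shows "finite (K \<inter> leaf x)"
proof -
  obtain m where sub: "submanifold m N" using N by (auto simp: transversal_def)
  have NV: "topspace N \<subseteq> V" and KN: "K \<subseteq> topspace N"
    using N K by (auto simp: transversal_def compactin_def)
  define \<U> where "\<U> = {W. openin N W \<and> finite (W \<inter> leaf x)}"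
  have "\<exists>W\<in>\<U>. y \<in> W" if y: "y \<in> K" for y
  proof (cases "y \<in> leaf x")
    case True
    then obtain W where W: "openin N W" "y \<in> W" "W \<inter> leaf x \<subseteq> {y}"
      using transversal_meets_leaf_isolated[OF N subsetD[OF KN y]] unfolding leaf_eq[OF True] by blast
    then have "finite (W \<inter> leaf x)" by (auto intro: finite_subset[of _ "{y}"])
    then show ?thesis using W by (auto simp: \<U>_def)
  next
    case False
    have "openin N (topspace N \<inter> (V - leaf x))"
      by (rule submanifold_openin_Int[OF sub open_off_leaf])
    moreover have "topspace N \<inter> (V - leaf x) \<inter> leaf x = {}" by auto
    ultimately have "topspace N \<inter> (V - leaf x) \<in> \<U>" by (simp add: \<U>_def)
    moreover have "y \<in> topspace N \<inter> (V - leaf x)" using y KN NV False by auto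
    ultimately show ?thesis by (rule bexI[rotated])
  qed
  then have "K \<subseteq> \<Union>\<U>" by blast
  then have "\<exists>\<F>. finite \<F> \<and> \<F> \<subseteq> \<U> \<and> K \<subseteq> \<Union>\<F>"
    by (intro compactinD[OF K]) (auto simp: \<U>_def)
  then obtain \<F> where F: "finite \<F>" "\<F> \<subseteq> \<U>" "K \<subseteq> \<Union>\<F>" by blast
  have "finite (\<Union>W\<in>\<F>. W \<inter> leaf x)"
    using F(1,2) by (intro finite_UN_I) (auto simp: \<U>_def)
  then show ?thesis by (rule finite_subset[rotated]) (use F(3) in auto)
qed

text \<open>The transverse measure is the number of points on one fixed leaf. A map that slides points along leaves
  restricts to a bijection between the points on that leaf, and a one-point transversal on it has measure 1.\<close>

theorem measurable_foliation_D:
  assumes "V \<noteq> {}"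
  shows "measurable_foliation V (DIM('a) - 1) D"
proof -
  obtain x where x: "x \<in> V" using assms by auto
  define \<Lambda> where "\<Lambda> B = emeasure (count_space UNIV) (B \<inter> leaf x)" for B
  let ?T = "borel_transversals V (DIM('a) - 1) D"
  have "positive ?T \<Lambda>" by (simp add: positive_def \<Lambda>_def)
  moreover have "countably_additive ?T \<Lambda>"
    unfolding countably_additive_def
  proof (intro allI impI)
    fix B :: "nat \<Rightarrow> 'a set" assume "disjoint_family B"
    then have "disjoint_family (\<lambda>i. B i \<inter> leaf x)" by (auto simp: disjoint_family_on_def)
    then have "(\<Sum>i. \<Lambda> (B i)) = emeasure (count_space UNIV) (\<Union>i. B i \<inter> leaf x)"
      unfolding \<Lambda>_def by (intro suminf_emeasure) auto
    then show "(\<Sum>i. \<Lambda> (B i)) = \<Lambda> (\<Union>i. B i)" by (simp add: \<Lambda>_def)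
  qed
  moreover have "\<Lambda> B1 = \<Lambda> B2" if \<psi>: "bij_betw \<psi> B1 B2" "\<forall>y\<in>B1. \<exists>L\<in>leaves V (DIM('a) - 1) D. y \<in> L \<and> \<psi> y \<in> L"
    for B1 B2 \<psi>
  proof -
    \<comment> \<open>Leaves are disjoint, so \<open>y\<close> and \<open>\<psi> y\<close> lie on the chosen leaf together or not at all.\<close>
    have iff: "\<psi> y \<in> leaf x \<longleftrightarrow> y \<in> leaf x" if "y \<in> B1" for y
      using \<psi>(2) that unfolding leaves_eq by (auto simp: leaf_def)
    have "bij_betw \<psi> (B1 \<inter> leaf x) (B2 \<inter> leaf x)"
      using \<psi>(1) iff unfolding bij_betw_def by (auto simp: inj_on_def)
    then show ?thesis
      unfolding \<Lambda>_def using bij_betw_finite bij_betw_same_card by (metis emeasure_count_space subset_UNIV)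
  qed
  moreover have "\<Lambda> K < \<infinity>" if "transversal V D N" "compactin N K" for N K
    using finite_compact_transversal_Int_leaf[OF that, of x] by (simp add: \<Lambda>_def emeasure_count_space_finite of_nat_less_top)
  ultimately have "transverse_measure V (DIM('a) - 1) D \<Lambda>"
    unfolding transverse_measure_def by blast
  moreover have "{x} \<in> ?T" using x by (simp add: borel_transversals_def countable_subset)
  moreover have "\<Lambda> {x} \<noteq> 0" using leaf_refl[OF x] by (simp add: \<Lambda>_def)
  ultimately show ?thesis unfolding measurable_foliation_def using foliation_D by blast
qed

end

section \<open>The adjoint representation of a Lie group\<close>

lemma chart_facts:
  assumes "is_chart (U, \<phi>)"
  shows "open U" "open (\<phi> ` U)" "continuous_on U \<phi>" "continuous_on (\<phi> ` U) (inv_into U \<phi>)" "inj_on \<phi> U"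
  using assms unfolding is_chart_def homeomorphism_def by (auto intro: inj_on_inverseI)

text \<open>Smoothness of a map from a Euclidean space into a manifold. Working with such parametrised families of
  group elements, rather than with charts on both sides, lets products and inverses be composed freely.\<close>

definition smooth_into ::
    "('g::topological_space, 'e::euclidean_space) chart set \<Rightarrow> 'a::euclidean_space set \<Rightarrow> ('a \<Rightarrow> 'g) \<Rightarrow> bool"
  where "smooth_into A S f \<longleftrightarrow> continuous_on S f \<and>
           (\<forall>(W, \<psi>)\<in>A. smooth_on (S \<inter> f -` W) (\<lambda>x. \<psi> (f x)))"

lemma smooth_into_chartD:
  assumes "smooth_into A S f" "(W, \<psi>) \<in> A" "T \<subseteq> S" "f ` T \<subseteq> W"
  shows "smooth_on T (\<lambda>x. \<psi> (f x))"
proof -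
  have "smooth_on (S \<inter> f -` W) (\<lambda>x. \<psi> (f x))" using assms by (auto simp: smooth_into_def)
  then show ?thesis by (rule smooth_on_subset) (use assms in auto)
qed

lemma smooth_into_compose:
  assumes "smooth_into A T f" "open T" "smooth_on S h" "open S" "h ` S \<subseteq> T" "smooth_atlas A"
  shows "smooth_into A S (\<lambda>x. f (h x))"
proof -
  have h: "continuous_on S h" by (rule smooth_on_continuous_on[OF assms(3)])
  have f: "continuous_on T f" using assms(1) by (simp add: smooth_into_def)
  have "smooth_on (S \<inter> (\<lambda>x. f (h x)) -` W) (\<lambda>x. \<psi> (f (h x)))" if W: "(W, \<psi>) \<in> A" for W \<psi>
  proof -
    from W have "open W" using assms(6) chart_facts unfolding smooth_atlas_def by blast
    have T': "open (T \<inter> f -` W)"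
      using f \<open>open T\<close> \<open>open W\<close> by (rule continuous_open_preimage)
    have "open (S \<inter> h -` (T \<inter> f -` W))"
      using h \<open>open S\<close> T' by (rule continuous_open_preimage)
    moreover have "S \<inter> h -` (T \<inter> f -` W) = S \<inter> (\<lambda>x. f (h x)) -` W" using assms(5) by auto
    ultimately have "open (S \<inter> (\<lambda>x. f (h x)) -` W)" by simp
    then show ?thesis
      by (rule smooth_on_compose[OF _ T'])
         (use assms(1,3,5) W in \<open>auto simp: smooth_into_def intro: smooth_on_subset\<close>)
  qed
  then show ?thesis
    using continuous_on_compose2[OF f h] assms(5) by (auto simp: smooth_into_def)
qed

locale lie_group_atlas =
  fixes G :: "'g::{t2_space, second_countable_topology} monoid" (structure)
    and A :: "('g, 'e::euclidean_space) chart set"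
  assumes lie_group: "lie_group G A"
begin

sublocale group G
  using lie_group by (simp add: lie_group_def)

lemma carrier_UNIV [simp]: "carrier G = UNIV"
  using lie_group by (simp add: lie_group_def)

lemma atlas: "smooth_atlas A"
  using lie_group by (simp add: lie_group_def)

lemma chart: "(U, \<phi>) \<in> A \<Longrightarrow> is_chart (U, \<phi>)"
  using atlas by (auto simp: smooth_atlas_def)

lemma chart_around: obtains U \<phi> where "(U, \<phi>) \<in> A" "x \<in> U"
proof -
  have "x \<in> \<Union> (fst ` A)" using atlas by (simp add: smooth_atlas_def)
  then show ?thesis using that by fastforce
qed

lemma smooth_into_inverse_chart:
  assumes "(U, \<phi>) \<in> A"
  shows "smooth_into A (\<phi> ` U) (inv_into U \<phi>)"
proof -
  note C = chart_facts[OF chart[OF assms]]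
  have "smooth_on (\<phi> ` U \<inter> inv_into U \<phi> -` W) (\<lambda>x. \<psi> (inv_into U \<phi> x))" if "(W, \<psi>) \<in> A" for W \<psi>
  proof -
    have "smooth_on (\<phi> ` (U \<inter> W)) (\<psi> \<circ> inv_into U \<phi>)"
      using atlas assms that unfolding smooth_atlas_def by blast
    moreover have "\<phi> ` U \<inter> inv_into U \<phi> -` W \<subseteq> \<phi> ` (U \<inter> W)"
      using C(5) by auto
    ultimately show ?thesis unfolding o_def by (rule smooth_on_subset)
  qed
  then show ?thesis using C(4) by (auto simp: smooth_into_def)
qed

lemma smooth_into_const: "open S \<Longrightarrow> smooth_into A S (\<lambda>x. g)"
proof -
  assume "open S"
  then have "open (S \<inter> (\<lambda>x. g) -` W)" for W by (cases "g \<in> W") auto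
  then show ?thesis by (auto simp: smooth_into_def smooth_on_const)
qed

lemma continuous_on_mult: "continuous_on UNIV (\<lambda>p. fst p \<otimes> snd p)"
  using lie_group by (simp add: lie_group_def smooth_map_def case_prod_beta')

lemma continuous_on_mult':
  "continuous_on S f \<Longrightarrow> continuous_on S g \<Longrightarrow> continuous_on S (\<lambda>x. f x \<otimes> g x)"
  using continuous_on_compose2[OF continuous_on_mult continuous_on_Pair] by force

lemma continuous_on_inv: "continuous_on UNIV (\<lambda>x. inv x)"
  using lie_group by (simp add: lie_group_def smooth_map_def)

text \<open>Smoothness is local, so near each point the product may be computed in a product chart around the two
  factors, where it is the coordinate expression of the group multiplication.\<close>

lemma smooth_into_mult:
  assumes S: "open S" and f: "smooth_into A S f" and g: "smooth_into A S g"
  shows "smooth_into A S (\<lambda>x. f x \<otimes> g x)"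
proof -
  have cf: "continuous_on S f" and cg: "continuous_on S g"
    using f g by (auto simp: smooth_into_def)
  have cfg: "continuous_on S (\<lambda>x. f x \<otimes> g x)" by (rule continuous_on_mult'[OF cf cg])
  have "smooth_on (S \<inter> (\<lambda>x. f x \<otimes> g x) -` W) (\<lambda>x. \<psi> (f x \<otimes> g x))" if W: "(W, \<psi>) \<in> A" for W \<psi>
  proof (rule smooth_on_local)
    let ?S = "S \<inter> (\<lambda>x. f x \<otimes> g x) -` W"
    have oW: "open W" using chart_facts(1)[OF chart[OF W]] .
    have oS: "open ?S" using cfg S oW by (rule continuous_open_preimage)
    fix x assume x: "x \<in> ?S"
    obtain U1 \<phi>1 where U1: "(U1, \<phi>1) \<in> A" "f x \<in> U1" by (rule chart_around)
    obtain U2 \<phi>2 where U2: "(U2, \<phi>2) \<in> A" "g x \<in> U2" by (rule chart_around)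
    note C1 = chart_facts[OF chart[OF U1(1)]] and C2 = chart_facts[OF chart[OF U2(1)]]
    let ?\<sigma>1 = "inv_into U1 \<phi>1" and ?\<sigma>2 = "inv_into U2 \<phi>2"
    define F where "F = (\<lambda>p. \<psi> (?\<sigma>1 (fst p) \<otimes> ?\<sigma>2 (snd p)))"
    define T where "T = (\<phi>1 ` U1 \<times> \<phi>2 ` U2) \<inter> (\<lambda>p. ?\<sigma>1 (fst p) \<otimes> ?\<sigma>2 (snd p)) -` W"
    have "continuous_on (\<phi>1 ` U1 \<times> \<phi>2 ` U2) (\<lambda>p. ?\<sigma>1 (fst p) \<otimes> ?\<sigma>2 (snd p))"
      by (intro continuous_on_mult' continuous_on_compose2[OF C1(4)] continuous_on_compose2[OF C2(4)] continuous_intros) auto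
    then have oT: "open T"
      unfolding T_def using oW C1(2) C2(2) by (intro continuous_open_preimage open_Times)
    have "(U1 \<times> U2, map_prod \<phi>1 \<phi>2) \<in> prod_atlas A A"
      using U1 U2 by (auto simp: prod_atlas_def)
    moreover have "smooth_map (prod_atlas A A) A (\<lambda>(x, y). x \<otimes> y)"
      using lie_group by (simp add: lie_group_def)
    ultimately have sm: "smooth_on (map_prod \<phi>1 \<phi>2 ` (U1 \<times> U2 \<inter> (\<lambda>(x, y). x \<otimes> y) -` W))
        (\<psi> \<circ> (\<lambda>(x, y). x \<otimes> y) \<circ> inv_into (U1 \<times> U2) (map_prod \<phi>1 \<phi>2))"
      using W unfolding smooth_map_def by blast
    have inj: "inj_on (map_prod \<phi>1 \<phi>2) (U1 \<times> U2)"
      using C1(5) C2(5) by (rule map_prod_inj_on)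
    have inv: "inv_into (U1 \<times> U2) (map_prod \<phi>1 \<phi>2) (\<phi>1 u, \<phi>2 v) = (u, v)" if "u \<in> U1" "v \<in> U2" for u v
      using inv_into_f_f[OF inj, of "(u, v)"] that by simp
    have "T \<subseteq> map_prod \<phi>1 \<phi>2 ` (U1 \<times> U2 \<inter> (\<lambda>(x, y). x \<otimes> y) -` W)"
    proof
      fix p assume "p \<in> T"
      then obtain u v where "u \<in> U1" "v \<in> U2" "p = (\<phi>1 u, \<phi>2 v)" "u \<otimes> v \<in> W"
        using C1(5) C2(5) by (auto simp: T_def)
      then show "p \<in> map_prod \<phi>1 \<phi>2 ` (U1 \<times> U2 \<inter> (\<lambda>(x, y). x \<otimes> y) -` W)"
        by (intro image_eqI[of _ _ "(u, v)"]) auto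
    qed
    then have smT: "smooth_on T F"
      by (intro smooth_on_cong[OF oT _ smooth_on_subset[OF sm]])
         (use inv C1(5) C2(5) in \<open>auto simp: T_def F_def\<close>)
    define N where "N = (S \<inter> f -` U1) \<inter> (S \<inter> g -` U2)"
    have oN: "open N"
      unfolding N_def using S cf cg C1(1) C2(1) by (intro open_Int continuous_open_preimage)
    have "smooth_on (?S \<inter> N) (\<lambda>y. F (\<phi>1 (f y), \<phi>2 (g y)))"
    proof (rule smooth_on_compose[OF _ oT smT])
      show "open (?S \<inter> N)" using oS oN by auto
      then show "smooth_on (?S \<inter> N) (\<lambda>y. (\<phi>1 (f y), \<phi>2 (g y)))"
        by (intro smooth_on_Pair smooth_into_chartD[OF f U1(1)] smooth_into_chartD[OF g U2(1)])
           (auto simp: N_def)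
      show "(\<lambda>y. (\<phi>1 (f y), \<phi>2 (g y))) ` (?S \<inter> N) \<subseteq> T"
        using C1(5) C2(5) by (auto simp: T_def N_def)
    qed
    then have "smooth_on (?S \<inter> N) (\<lambda>x. \<psi> (f x \<otimes> g x))"
      by (rule smooth_on_cong[rotated 2]) (use oS oN C1(5) C2(5) in \<open>auto simp: F_def N_def\<close>)
    then show "\<exists>N. open N \<and> x \<in> N \<and> smooth_on (?S \<inter> N) (\<lambda>x. \<psi> (f x \<otimes> g x))"
      using oN x U1(2) U2(2) by (intro exI[of _ N]) (auto simp: N_def)
  qed
  then show ?thesis using cfg by (auto simp: smooth_into_def)
qed

lemma smooth_into_inv:
  assumes S: "open S" and f: "smooth_into A S f"
  shows "smooth_into A S (\<lambda>x. inv (f x))"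
proof -
  have cf: "continuous_on S f" using f by (auto simp: smooth_into_def)
  have ci: "continuous_on S (\<lambda>x. inv (f x))"
    using continuous_on_compose2[OF continuous_on_inv cf] by auto
  have "smooth_on (S \<inter> (\<lambda>x. inv (f x)) -` W) (\<lambda>x. \<psi> (inv (f x)))" if W: "(W, \<psi>) \<in> A" for W \<psi>
  proof (rule smooth_on_local)
    let ?S = "S \<inter> (\<lambda>x. inv (f x)) -` W"
    have oW: "open W" using chart_facts(1)[OF chart[OF W]] .
    have oS: "open ?S" using ci S oW by (rule continuous_open_preimage)
    fix x assume x: "x \<in> ?S"
    obtain U \<phi> where U: "(U, \<phi>) \<in> A" "f x \<in> U" by (rule chart_around)
    note C = chart_facts[OF chart[OF U(1)]]
    let ?\<sigma> = "inv_into U \<phi>"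
    have "smooth_map A A (\<lambda>x. inv x)"
      using lie_group by (simp add: lie_group_def)
    then have sm: "smooth_on (\<phi> ` (U \<inter> (\<lambda>x. inv x) -` W)) (\<lambda>y. \<psi> (inv (?\<sigma> y)))"
      using W U(1) unfolding smooth_map_def o_def by blast
    define T where "T = \<phi> ` U \<inter> (\<lambda>y. inv (?\<sigma> y)) -` W"
    have "continuous_on (\<phi> ` U) (\<lambda>y. inv (?\<sigma> y))"
      using continuous_on_compose2[OF continuous_on_inv C(4)] by auto
    then have oT: "open T"
      unfolding T_def using oW C(2) by (intro continuous_open_preimage)
    have "T \<subseteq> \<phi> ` (U \<inter> (\<lambda>x. inv x) -` W)"
      using C(5) by (auto simp: T_def)
    then have smT: "smooth_on T (\<lambda>y. \<psi> (inv (?\<sigma> y)))" using sm by (rule smooth_on_subset[rotated])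
    define N where "N = S \<inter> f -` U"
    have oN: "open N"
      unfolding N_def using S cf C(1) by (intro continuous_open_preimage)
    have oSN: "open (?S \<inter> N)" using oS oN by auto
    have "smooth_on (?S \<inter> N) (\<lambda>y. \<psi> (inv (?\<sigma> (\<phi> (f y)))))"
      by (rule smooth_on_compose[OF oSN oT smT smooth_into_chartD[OF f U(1)]])
         (use C(5) in \<open>auto simp: T_def N_def\<close>)
    then have "smooth_on (?S \<inter> N) (\<lambda>x. \<psi> (inv (f x)))"
      by (rule smooth_on_cong[OF oSN, rotated]) (use C(5) in \<open>auto simp: N_def\<close>)
    then show "\<exists>N. open N \<and> x \<in> N \<and> smooth_on (?S \<inter> N) (\<lambda>x. \<psi> (inv (f x)))"
      using oN x U(2) by (intro exI[of _ N]) (auto simp: N_def)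
  qed
  then show ?thesis using ci by (auto simp: smooth_into_def)
qed

end

locale lie_group_chart = lie_group_atlas G A
  for G :: "'g::{t2_space, second_countable_topology} monoid" (structure)
    and A :: "('g, 'e::euclidean_space) chart set" +
  fixes U :: "'g set" and \<phi> :: "'g \<Rightarrow> 'e"
  assumes U\<phi>: "(U, \<phi>) \<in> A" and one_U: "\<one> \<in> U"
begin

abbreviation \<sigma> :: "'e \<Rightarrow> 'g" where "\<sigma> \<equiv> inv_into U \<phi>"
abbreviation e0 :: 'e where "e0 \<equiv> \<phi> \<one>"
abbreviation \<Omega> :: "'e set" where "\<Omega> \<equiv> \<phi> ` U"
abbreviation Adj :: "'g \<Rightarrow> 'e \<Rightarrow> 'e" where "Adj \<equiv> Ad G (U, \<phi>)"

text \<open>Conjugation by \<open>g\<close> in the chart around the identity; \<open>Ad g\<close> is its derivative at the point \<open>e0\<close>.\<close>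

definition conj_map :: "'g \<Rightarrow> 'e \<Rightarrow> 'e"
  where "conj_map g y = \<phi> (g \<otimes> \<sigma> y \<otimes> inv g)"

lemmas chart_U = chart_facts[OF chart[OF U\<phi>]]

lemma \<sigma>_\<phi> [simp]: "x \<in> U \<Longrightarrow> \<sigma> (\<phi> x) = x"
  using chart_U(5) by simp

lemma \<sigma>_mem [simp]: "y \<in> \<Omega> \<Longrightarrow> \<sigma> y \<in> U"
  by auto

lemma \<phi>_\<sigma> [simp]: "y \<in> \<Omega> \<Longrightarrow> \<phi> (\<sigma> y) = y"
  by auto

lemma \<sigma>_e0 [simp]: "\<sigma> e0 = \<one>"
  using one_U by simp

lemma e0_mem [simp]: "e0 \<in> \<Omega>"
  using one_U by simp

lemma smooth_chart_of:
  assumes "open S" "smooth_into A S f"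
  shows "open (S \<inter> f -` U)" "smooth_on (S \<inter> f -` U) (\<lambda>x. \<phi> (f x))"
  using assms chart_U(1) U\<phi> by (auto simp: smooth_into_def intro!: continuous_open_preimage)

lemma smooth_\<sigma>: "smooth_into A \<Omega> \<sigma>"
  by (rule smooth_into_inverse_chart[OF U\<phi>])

lemma Adj_eq: "Adj g = frechet_derivative (conj_map g) (at e0)"
  by (simp add: Ad_def conj_map_def[abs_def])

lemma conj_map_domain:
  defines "S g \<equiv> \<Omega> \<inter> (\<lambda>y. g \<otimes> \<sigma> y \<otimes> inv g) -` U"
  shows "open (S g)" "e0 \<in> S g" "smooth_on (S g) (conj_map g)"
proof -
  have "smooth_into A \<Omega> (\<lambda>y. g \<otimes> \<sigma> y \<otimes> inv g)"
    by (intro smooth_into_mult smooth_into_const smooth_\<sigma> chart_U(2))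
  from smooth_chart_of[OF chart_U(2) this] show "open (S g)" "smooth_on (S g) (conj_map g)"
    by (simp_all add: S_def conj_map_def[abs_def])
  show "e0 \<in> S g" using one_U by (simp add: S_def)
qed

lemma conj_map_e0 [simp]: "conj_map g e0 = e0"
  by (simp add: conj_map_def)

lemma conj_map_has_derivative: "(conj_map g has_derivative Adj g) (at e0)"
  unfolding Adj_eq using conj_map_domain smooth_on_has_derivative by blast

lemma linear_Adj: "linear (Adj g)"
  using conj_map_has_derivative by (rule has_derivative_linear)

lemma Adj_mult: "Adj (g \<otimes> h) v = Adj g (Adj h v)"
proof -
  have "((\<lambda>y. conj_map g (conj_map h y)) has_derivative (\<lambda>v. Adj g (Adj h v))) (at e0)"
    using has_derivative_compose[OF conj_map_has_derivative, of "conj_map g" "Adj g" h] conj_map_has_derivative by simp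
  then have "(conj_map (g \<otimes> h) has_derivative (\<lambda>v. Adj g (Adj h v))) (at e0)"
  proof (rule has_derivative_transform_within_open[OF _ conj_map_domain(1,2)[of h]])
    fix y assume "y \<in> \<Omega> \<inter> (\<lambda>y. h \<otimes> \<sigma> y \<otimes> inv h) -` U"
    then show "conj_map g (conj_map h y) = conj_map (g \<otimes> h) y"
      by (simp add: conj_map_def m_assoc inv_mult_group)
  qed
  from fun_cong[OF has_derivative_unique[OF this conj_map_has_derivative]] show ?thesis by simp
qed

lemma Adj_one: "Adj \<one> v = v"
proof -
  have "((\<lambda>y. y) has_derivative Adj \<one>) (at e0)"
    by (rule has_derivative_transform_within_open[OF conj_map_has_derivative chart_U(2)]) (auto simp: conj_map_def)
  from fun_cong[OF has_derivative_unique[OF this has_derivative_ident]] show ?thesis .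
qed

text \<open>Conjugation is jointly smooth in both of its arguments, and \<open>Ad\<close> is a directional derivative of this
  function of two variables in the second one, hence smooth in the first.\<close>

lemma smooth_Adj: "smooth_on \<Omega> (\<lambda>y. Adj (\<sigma> y) v)"
proof -
  let ?f = "\<lambda>p. \<sigma> (fst p) \<otimes> \<sigma> (snd p) \<otimes> inv (\<sigma> (fst p))"
  have o2: "open (\<Omega> \<times> \<Omega>)" by (intro open_Times chart_U(2))
  have pr: "smooth_on (\<Omega> \<times> \<Omega>) fst" "smooth_on (\<Omega> \<times> \<Omega>) snd"
    using smooth_on_linear[OF o2 bounded_linear_fst smooth_on_id[OF o2]]
      smooth_on_linear[OF o2 bounded_linear_snd smooth_on_id[OF o2]] by auto
  have "smooth_into A (\<Omega> \<times> \<Omega>) (\<lambda>p. \<sigma> (fst p))" "smooth_into A (\<Omega> \<times> \<Omega>) (\<lambda>p. \<sigma> (snd p))"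
    by (rule smooth_into_compose[OF smooth_\<sigma> chart_U(2) _ o2 _ atlas]; use pr in auto)+
  then have "smooth_into A (\<Omega> \<times> \<Omega>) ?f"
    by (intro smooth_into_mult smooth_into_inv o2)
  note M = smooth_chart_of[OF o2 this]
  define M where "M p = \<phi> (?f p)" for p
  define O2 where "O2 = \<Omega> \<times> \<Omega> \<inter> ?f -` U"
  have O2: "open O2" "smooth_on O2 M" using M by (simp_all add: O2_def M_def[abs_def])
  have mem: "(y, e0) \<in> O2" if "y \<in> \<Omega>" for y using that one_U by (simp add: O2_def)
  have eq: "frechet_derivative M (at (y, e0)) (0, v) = Adj (\<sigma> y) v" if "y \<in> \<Omega>" for y
  proof -
    have "(M has_derivative frechet_derivative M (at (y, e0))) (at (y, e0))"
      using smooth_on_has_derivative[OF O2(2) mem[OF that]] .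
    moreover have "((\<lambda>z. (y, z)) has_derivative (\<lambda>v. (0, v))) (at e0)"
      by (intro has_derivative_Pair has_derivative_const has_derivative_ident)
    ultimately have "((\<lambda>z. M (y, z)) has_derivative (\<lambda>v. frechet_derivative M (at (y, e0)) (0, v))) (at e0)"
      by (rule has_derivative_compose[rotated])
    moreover have "(\<lambda>z. M (y, z)) = conj_map (\<sigma> y)" by (simp add: M_def conj_map_def[abs_def])
    ultimately have "(conj_map (\<sigma> y) has_derivative (\<lambda>v. frechet_derivative M (at (y, e0)) (0, v))) (at e0)"
      by simp
    from fun_cong[OF has_derivative_unique[OF conj_map_has_derivative this]] show ?thesis by simp
  qed
  have "smooth_on \<Omega> (\<lambda>y. frechet_derivative M (at (y, e0)) (0, v))"
  proof (rule smooth_on_compose[OF chart_U(2) O2(1) smooth_on_frechet_derivative[OF O2(2)]])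
    show "smooth_on \<Omega> (\<lambda>y. (y, e0))"
      by (intro smooth_on_Pair chart_U(2) smooth_on_id smooth_on_const)
    show "(\<lambda>y. (y, e0)) ` \<Omega> \<subseteq> O2" by (intro image_subsetI mem)
  qed
  then show ?thesis by (rule smooth_on_cong[OF chart_U(2), rotated]) (rule eq)
qed

lemma Adj_has_derivative:
  "((\<lambda>y. Adj (\<sigma> y) v) has_derivative (\<lambda>u. group_bracket G (U, \<phi>) u v)) (at e0)"
proof -
  \<comment> \<open>The bracket is defined by derivatives along lines only; smoothness makes them one linear map.\<close>
  obtain L where L: "((\<lambda>y. Adj (\<sigma> y) v) has_derivative L) (at e0)"
    using smooth_on_has_derivative[OF smooth_Adj e0_mem] by blast
  have "L u = group_bracket G (U, \<phi>) u v" for u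
  proof -
    have "((\<lambda>t. e0 + t *\<^sub>R u) has_derivative (\<lambda>t. t *\<^sub>R u)) (at 0)"
      by (auto intro!: derivative_eq_intros)
    then have "((\<lambda>t. Adj (\<sigma> (e0 + t *\<^sub>R u)) v) has_derivative (\<lambda>t. L (t *\<^sub>R u))) (at 0)"
      using has_derivative_compose[of "\<lambda>t. e0 + t *\<^sub>R u" "\<lambda>t. t *\<^sub>R u" 0 UNIV "\<lambda>y. Adj (\<sigma> y) v" L] L by simp
    then have "((\<lambda>t. Adj (\<sigma> (e0 + t *\<^sub>R u)) v) has_vector_derivative L u) (at 0)"
      using linear_scale[OF has_derivative_linear[OF L]] by (simp add: has_vector_derivative_def)
    then show ?thesis by (simp add: group_bracket_def vector_derivative_at)
  qed
  then show ?thesis using L by presburger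
qed

text \<open>Moving along the group near \<open>g\<close> is a left translate of moving near the identity: for \<open>y\<close> in the chart the
  function at \<open>g \<otimes> \<sigma> z\<close> is its translate by \<open>g \<otimes> \<sigma> y\<close> evaluated at the smooth function
  \<open>inv (\<sigma> y) \<otimes> \<sigma> z\<close> of \<open>z\<close>. So zero derivatives at the identity give zero derivatives on a whole ball of the
  chart, hence a locally constant function.\<close>

lemma constant_if_left_derivative_zero:
  fixes \<Psi> :: "'g \<Rightarrow> 'b::real_normed_vector"
  assumes conn: "connected (UNIV :: 'g set)"
    and zero: "\<And>g. ((\<lambda>y. \<Psi> (g \<otimes> \<sigma> y)) has_derivative (\<lambda>_. 0)) (at e0)"
  shows "\<Psi> g = \<Psi> h"
proof (rule connected_local_const[OF conn, of g h])
  show "\<forall>g\<in>UNIV. \<forall>\<^sub>F h in at g within UNIV. \<Psi> g = \<Psi> h"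
  proof
    fix g
    obtain r where r: "r > 0" "ball e0 r \<subseteq> \<Omega>"
      using chart_U(2) e0_mem open_contains_ball by meson
    have "((\<lambda>y. \<Psi> (g \<otimes> \<sigma> y)) has_derivative (\<lambda>_. 0)) (at y within ball e0 r)" if y: "y \<in> ball e0 r" for y
    proof -
      have y\<Omega>: "y \<in> \<Omega>" using r y by auto
      define \<tau> where "\<tau> z = \<phi> (inv (\<sigma> y) \<otimes> \<sigma> z)" for z
      define S where "S = \<Omega> \<inter> (\<lambda>z. inv (\<sigma> y) \<otimes> \<sigma> z) -` U"
      have "smooth_into A \<Omega> (\<lambda>z. inv (\<sigma> y) \<otimes> \<sigma> z)"
        by (intro smooth_into_mult smooth_into_const smooth_\<sigma> chart_U(2))
      from smooth_chart_of[OF chart_U(2) this] have S: "open S" "smooth_on S \<tau>"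
        by (simp_all add: S_def \<tau>_def[abs_def])
      have yS: "y \<in> S" and \<tau>y: "\<tau> y = e0" using y\<Omega> one_U by (simp_all add: S_def \<tau>_def)
      have "((\<lambda>z. \<Psi> (g \<otimes> \<sigma> y \<otimes> \<sigma> (\<tau> z))) has_derivative (\<lambda>_. 0)) (at y)"
        using has_derivative_compose[OF smooth_on_has_derivative[OF S(2) yS], of "\<lambda>w. \<Psi> (g \<otimes> \<sigma> y \<otimes> \<sigma> w)" "\<lambda>_. 0"]
          zero[of "g \<otimes> \<sigma> y"] \<tau>y by simp
      then have "((\<lambda>z. \<Psi> (g \<otimes> \<sigma> z)) has_derivative (\<lambda>_. 0)) (at y)"
      proof (rule has_derivative_transform_within_open[OF _ S(1) yS])
        fix z assume "z \<in> S"
        then have "g \<otimes> \<sigma> y \<otimes> \<sigma> (\<tau> z) = g \<otimes> (\<sigma> y \<otimes> (inv (\<sigma> y) \<otimes> \<sigma> z))"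
          by (simp add: \<tau>_def S_def m_assoc)
        also have "\<dots> = g \<otimes> \<sigma> z" by (simp flip: m_assoc)
        finally show "\<Psi> (g \<otimes> \<sigma> y \<otimes> \<sigma> (\<tau> z)) = \<Psi> (g \<otimes> \<sigma> z)" by simp
      qed
      then show ?thesis by (rule has_derivative_at_withinI)
    qed
    then obtain k where k: "\<And>y. y \<in> ball e0 r \<Longrightarrow> \<Psi> (g \<otimes> \<sigma> y) = k"
      using has_derivative_zero_constant[OF convex_ball] by blast
    have kg: "\<Psi> g = k" using k[of e0] r(1) by simp
    define N where "N = (\<lambda>h. inv g \<otimes> h) -` (U \<inter> \<phi> -` ball e0 r)"
    have "open (U \<inter> \<phi> -` ball e0 r)"
      using chart_U(3,1) by (intro continuous_open_preimage) auto
    then have "open N"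
      unfolding N_def by (rule open_vimage) (intro continuous_on_mult' continuous_intros)
    moreover have "g \<in> N" using one_U r(1) by (simp add: N_def)
    moreover have "\<Psi> g = \<Psi> h" if "h \<in> N" for h
    proof -
      have "\<sigma> (\<phi> (inv g \<otimes> h)) = inv g \<otimes> h" using that by (simp add: N_def)
      then have "g \<otimes> \<sigma> (\<phi> (inv g \<otimes> h)) = h" by (simp flip: m_assoc)
      then show ?thesis using k[of "\<phi> (inv g \<otimes> h)"] kg that by (simp add: N_def)
    qed
    ultimately show "\<forall>\<^sub>F h in at g within UNIV. \<Psi> g = \<Psi> h"
      unfolding eventually_at_topological by blast
  qed
qed auto

end

section \<open>Coadjoint orbits and leaves\<close>

text \<open>Up to sign the coadjoint vector field of \<open>u\<close>: the infinitesimal form of the action \<open>R\<close> below.\<close>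

definition coadjoint_field ::
    "(real ^ coord \<Rightarrow> real ^ coord \<Rightarrow> real ^ coord) \<Rightarrow> real ^ coord \<Rightarrow> real ^ coord \<Rightarrow> real ^ coord"
  where "coadjoint_field br u F = (\<chi> i. F \<bullet> br u (bas i))"

lemma has_derivative_vec:
  fixes f :: "'a::real_normed_vector \<Rightarrow> 'i::finite \<Rightarrow> real"
  assumes "\<And>i. ((\<lambda>x. f x i) has_derivative (\<lambda>v. f' v i)) (at a)"
  shows "((\<lambda>x. \<chi> i. f x i) has_derivative (\<lambda>v. \<chi> i. f' v i)) (at a)"
  by (subst has_derivative_componentwise_within) (use assms in \<open>auto simp: Basis_vec_def inner_axis\<close>)

lemma linear_bas_expansion:
  fixes h :: "real ^ 'n \<Rightarrow> 'b::real_vector"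
  assumes "linear h"
  shows "h Z = (\<Sum>i\<in>UNIV. Z $ i *\<^sub>R h (axis i 1))"
proof -
  have "h Z = h (\<Sum>i\<in>UNIV. Z $ i *\<^sub>R axis i 1)"
    using basis_expansion[of Z] by (simp add: scalar_mult_eq_scaleR)
  then show ?thesis by (simp add: linear_sum[OF assms] linear_scale[OF assms])
qed

text \<open>If a curve moves only along its own direction, the direction does not change.\<close>

lemma sgn_has_derivative_zero:
  fixes q :: "'a::real_normed_vector \<Rightarrow> 'b::real_inner"
  assumes "(q has_derivative q') (at a)" "q a \<noteq> 0" "\<And>u. \<exists>c. q' u = c *\<^sub>R q a"
  shows "((\<lambda>x. sgn (q x)) has_derivative (\<lambda>_. 0)) (at a)"
proof -
  have N: "((\<lambda>x. norm (q x)) has_derivative (\<lambda>u. q' u \<bullet> sgn (q a))) (at a)"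
    using has_derivative_compose[OF assms(1) has_derivative_norm[OF assms(2)]] .
  have "((\<lambda>x. inverse (norm (q x)) *\<^sub>R q x) has_derivative
     (\<lambda>u. inverse (norm (q a)) *\<^sub>R q' u + (- (inverse (norm (q a)) * (q' u \<bullet> sgn (q a)) * inverse (norm (q a)))) *\<^sub>R q a)) (at a)"
    using assms(2) by (intro has_derivative_scaleR Deriv.has_derivative_inverse[OF _ N] assms(1)) auto
  moreover have "inverse (norm (q a)) *\<^sub>R q' u + (- (inverse (norm (q a)) * (q' u \<bullet> sgn (q a)) * inverse (norm (q a)))) *\<^sub>R q a = 0" for u
  proof -
    obtain c where c: "q' u = c *\<^sub>R q a" using assms(3) by blast
    have "q a \<bullet> sgn (q a) = norm (q a)"
      using assms(2) by (simp add: sgn_div_norm dot_square_norm power2_eq_square)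
    then show ?thesis using assms(2) by (simp add: c)
  qed
  ultimately show ?thesis by (simp add: sgn_div_norm)
qed

locale coadjoint_action = lie_group_chart G A U \<phi>
  for G :: "'g::{t2_space, second_countable_topology} monoid" (structure)
    and A :: "('g, 'e::euclidean_space) chart set" and U \<phi> +
  fixes br :: "real ^ coord \<Rightarrow> real ^ coord \<Rightarrow> real ^ coord"
    and \<theta> :: "real ^ coord \<Rightarrow> 'e"
  assumes iso: "lie_algebra_iso br (group_bracket G (U, \<phi>)) \<theta>"
    and conn: "connected (UNIV :: 'g set)"
begin

abbreviation \<theta>' :: "'e \<Rightarrow> real ^ coord" where "\<theta>' \<equiv> inv_into UNIV \<theta>"

definition \<rho> :: "'g \<Rightarrow> real ^ coord \<Rightarrow> real ^ coord"
  where "\<rho> g v = \<theta>' (Adj g (\<theta> v))"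

text \<open>The coadjoint action of \<open>inv g\<close>. It is a right action with the same orbits, and its derivative at the identity
  is the bracket without a sign.\<close>

definition R :: "'g \<Rightarrow> real ^ coord \<Rightarrow> real ^ coord"
  where "R g F = (\<chi> i. F \<bullet> \<rho> g (bas i))"

lemma linear_\<theta>: "linear \<theta>" and bij_\<theta>: "bij \<theta>"
  and \<theta>_br: "\<theta> (br x y) = group_bracket G (U, \<phi>) (\<theta> x) (\<theta> y)"
  using iso by (auto simp: lie_algebra_iso_def)

lemma \<theta>'_\<theta> [simp]: "\<theta>' (\<theta> v) = v"
  using bij_\<theta> by (simp add: bij_is_inj)

lemma \<theta>_\<theta>' [simp]: "\<theta> (\<theta>' v) = v"
  using bij_\<theta> by (simp add: bij_is_surj surj_f_inv_f)

lemma linear_\<theta>': "linear \<theta>'"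
proof (rule linearI)
  fix x y r
  have "\<theta>' (x + y) = \<theta>' (\<theta> (\<theta>' x + \<theta>' y))" by (simp only: linear_add[OF linear_\<theta>] \<theta>_\<theta>')
  then show "\<theta>' (x + y) = \<theta>' x + \<theta>' y" by simp
  have "\<theta>' (r *\<^sub>R x) = \<theta>' (\<theta> (r *\<^sub>R \<theta>' x))" by (simp only: linear_scale[OF linear_\<theta>] \<theta>_\<theta>')
  then show "\<theta>' (r *\<^sub>R x) = r *\<^sub>R \<theta>' x" by simp
qed

lemma bounded_linear_\<theta>': "bounded_linear \<theta>'"
  using linear_\<theta>' by (rule linear_conv_bounded_linear[THEN iffD1])

lemma linear_\<rho>: "linear (\<rho> g)"
  using linear_compose[OF linear_compose[OF linear_\<theta> linear_Adj] linear_\<theta>']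
  by (simp add: \<rho>_def[abs_def] o_def)

lemma \<rho>_mult: "\<rho> (g \<otimes> h) v = \<rho> g (\<rho> h v)"
  by (simp add: \<rho>_def Adj_mult)

lemma \<rho>_one: "\<rho> \<one> v = v"
  by (simp add: \<rho>_def Adj_one)

lemma \<rho>_nonzero: "v \<noteq> 0 \<Longrightarrow> \<rho> g v \<noteq> 0"
  using \<rho>_mult[of "inv g" g v] \<rho>_one[of v] linear_0[OF linear_\<rho>] by auto

lemma \<rho>_has_derivative:
  "((\<lambda>y. \<rho> (g \<otimes> \<sigma> y) v) has_derivative (\<lambda>u. \<rho> g (br (\<theta>' u) v))) (at e0)"
proof -
  have "((\<lambda>y. \<theta>' (Adj (\<sigma> y) (\<theta> v))) has_derivative (\<lambda>u. \<theta>' (group_bracket G (U, \<phi>) u (\<theta> v)))) (at e0)"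
    by (rule bounded_linear.has_derivative[OF bounded_linear_\<theta>' Adj_has_derivative])
  moreover have "\<theta>' (group_bracket G (U, \<phi>) u (\<theta> v)) = br (\<theta>' u) v" for u
    using \<theta>_br[of "\<theta>' u" v] by (metis \<theta>'_\<theta> \<theta>_\<theta>')
  ultimately have "((\<lambda>y. \<rho> (\<sigma> y) v) has_derivative (\<lambda>u. br (\<theta>' u) v)) (at e0)"
    by (simp add: \<rho>_def)
  then show ?thesis
    unfolding \<rho>_mult
    by (rule bounded_linear.has_derivative[OF linear_conv_bounded_linear[THEN iffD1, OF linear_\<rho>]])
qed

lemma R_inner: "R g F \<bullet> Z = F \<bullet> \<rho> g Z"
proof -
  have "R g F \<bullet> Z = (\<Sum>i\<in>UNIV. Z $ i * (F \<bullet> \<rho> g (bas i)))"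
    by (simp add: inner_vec_def R_def mult.commute)
  also have "\<dots> = F \<bullet> \<rho> g Z"
    by (subst linear_bas_expansion[OF linear_\<rho>, of g Z]) (simp add: inner_sum_right)
  finally show ?thesis .
qed

lemma R_mult: "R (g \<otimes> h) F = R h (R g F)"
  by (simp add: R_def[of "g \<otimes> h"] R_def[of h] R_inner \<rho>_mult)

lemma R_one [simp]: "R \<one> F = F"
  by (simp add: R_def \<rho>_one inner_axis vec_eq_iff)

lemma coadjoint_orbit_eq: "coadjoint_orbit G (U, \<phi>) \<theta> F = range (\<lambda>g. R g F)"
proof -
  have "coadjoint G (U, \<phi>) \<theta> g F = R (inv g) F" for g
    by (simp add: coadjoint_def R_def \<rho>_def)
  then have "coadjoint_orbit G (U, \<phi>) \<theta> F = (\<lambda>g. R g F) ` range (\<lambda>g. inv g)"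
    by (auto simp: coadjoint_orbit_def)
  moreover have "range (\<lambda>g. inv g) = (UNIV :: 'g set)"
    by (rule surjI[of _ "\<lambda>g. inv g"]) simp
  ultimately show ?thesis by simp
qed

lemma R_orbit_eq: "F' \<in> range (\<lambda>g. R g F) \<Longrightarrow> range (\<lambda>g. R g F') = range (\<lambda>g. R g F)"
proof -
  assume "F' \<in> range (\<lambda>g. R g F)"
  then obtain h where h: "F' = R h F" by auto
  have "R g F' = R (h \<otimes> g) F" for g by (simp add: h R_mult)
  moreover have "R g F = R (inv h \<otimes> g) F'" for g by (simp add: h flip: R_mult m_assoc)
  ultimately show ?thesis by (auto simp: image_iff)
qed

lemma R_has_derivative:
  "((\<lambda>y. R (\<sigma> y) F) has_derivative (\<lambda>u. coadjoint_field br (\<theta>' u) F)) (at e0)"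
  unfolding R_def coadjoint_field_def
  using \<rho>_has_derivative[of \<one>]
  by (intro has_derivative_vec has_derivative_inner_right) (simp add: \<rho>_one)

lemma continuous_on_R: "continuous_on \<Omega> (\<lambda>y. R (\<sigma> y) F)"
  unfolding R_def \<rho>_def
  by (intro continuous_on_vec_lambda continuous_on_inner continuous_on_const
      bounded_linear.continuous_on[OF bounded_linear_\<theta>'] smooth_on_continuous_on[OF smooth_Adj])

text \<open>The derivative of \<open>\<lambda>g. \<rho> g w\<close> is everywhere a multiple of its value, so its direction is constant on the
  connected group.\<close>

lemma \<rho>_eigenvector:
  assumes "\<And>u. \<exists>c. br u w = c *\<^sub>R w" "w \<noteq> 0"
  shows "\<exists>a>0. \<rho> g w = a *\<^sub>R w"
proof -
  have "sgn (\<rho> g w) = sgn (\<rho> \<one> w)"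
  proof (rule constant_if_left_derivative_zero[OF conn])
    fix g
    show "((\<lambda>y. sgn (\<rho> (g \<otimes> \<sigma> y) w)) has_derivative (\<lambda>_. 0)) (at e0)"
    proof (rule sgn_has_derivative_zero[OF \<rho>_has_derivative])
      show "\<rho> (g \<otimes> \<sigma> e0) w \<noteq> 0" using \<rho>_nonzero[OF assms(2)] .
      show "\<exists>c. \<rho> g (br (\<theta>' u) w) = c *\<^sub>R \<rho> (g \<otimes> \<sigma> e0) w" for u
        using assms(1)[of "\<theta>' u"] by (auto simp: linear_scale[OF linear_\<rho>])
    qed
  qed
  then have "norm (\<rho> g w) *\<^sub>R sgn (\<rho> g w) = norm (\<rho> g w) *\<^sub>R sgn w"
    by (simp add: \<rho>_one)
  then have "\<rho> g w = (norm (\<rho> g w) / norm w) *\<^sub>R w"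
    using \<rho>_nonzero[OF assms(2), of g] by (simp add: sgn_div_norm divide_inverse)
  moreover have "norm (\<rho> g w) / norm w > 0"
    using \<rho>_nonzero[OF assms(2), of g] assms(2) by simp
  ultimately show ?thesis by blast
qed

text \<open>The orbit stays in the leaf because the height has zero derivative along it. It is open in the leaf because
  \<open>(y, s) \<mapsto> \<Phi> (R (\<sigma> y) F) + s b\<close> has a surjective derivative, hence covers a neighbourhood of \<open>\<Phi> F\<close>; the points
  of the leaf that are reached have \<open>s = 0\<close>. As this holds for all orbits in the leaf, and the leaf is
  connected, there is only one.\<close>

lemma orbit_eq_leaf:
  assumes "straightened_foliation V V' \<Phi> \<Psi> b \<kappa>"
    and pres: "\<And>F g. F \<in> V \<Longrightarrow> R g F \<in> V \<and> \<kappa> (R g F) = \<kappa> F"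
    and tang: "\<And>F u. F \<in> V \<Longrightarrow> frechet_derivative \<Phi> (at F) (coadjoint_field br u F) \<bullet> b = 0"
    and surj: "\<And>F v. F \<in> V \<Longrightarrow> frechet_derivative \<Phi> (at F) v \<bullet> b = 0 \<Longrightarrow> \<exists>u. coadjoint_field br u F = v"
    and F: "F \<in> V"
  shows "range (\<lambda>g. R g F) = straightened_foliation.leaf V \<Phi> b \<kappa> F"
proof -
  interpret straightened_foliation V V' \<Phi> \<Psi> b \<kappa> by fact
  have sub: "R g F \<in> leaf F" if F: "F \<in> V" for g F
  proof -
    have "\<Phi> (R g F) \<bullet> b = \<Phi> (R \<one> F) \<bullet> b"
    proof (rule constant_if_left_derivative_zero[OF conn])
      fix g
      have 1: "R (g \<otimes> \<sigma> y) F = R (\<sigma> y) (R g F)" for y by (rule R_mult)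
      have V: "R g F \<in> V" using pres[OF F] by blast
      have "((\<lambda>y. \<Phi> (R (\<sigma> y) (R g F)) \<bullet> b) has_derivative
          (\<lambda>u. d\<Phi> (R g F) (coadjoint_field br (\<theta>' u) (R g F)) \<bullet> b)) (at e0)"
        using has_derivative_compose[OF R_has_derivative, of \<Phi> "d\<Phi> (R g F)" "R g F"] \<Phi>_deriv[OF V]
        by (intro has_derivative_inner_left) simp
      then show "((\<lambda>y. \<Phi> (R (g \<otimes> \<sigma> y) F) \<bullet> b) has_derivative (\<lambda>_. 0)) (at e0)"
        unfolding 1 tang[OF V] .
    qed
    then show ?thesis using pres[OF F] by (simp add: leaf_def)
  qed
  have loc: "\<exists>N. open N \<and> F1 \<in> N \<and> N \<inter> leaf F1 \<subseteq> range (\<lambda>g. R g F1)" if F1: "F1 \<in> V" for F1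
  proof -
    \<comment> \<open>The orbit directions span only a hyperplane; the parameter \<open>s\<close> supplies the missing direction \<open>b\<close>, so that
        an open mapping theorem applies.\<close>
    define S where "S = \<Omega> \<times> (UNIV :: real set)"
    define m where "m p = \<Phi> (R (\<sigma> (fst p)) F1) + snd p *\<^sub>R b" for p
    define m' where "m' p = d\<Phi> F1 (coadjoint_field br (\<theta>' (fst p)) F1) + snd p *\<^sub>R b" for p
    have oS: "open S" unfolding S_def using chart_U(2) by (intro open_Times) auto
    have cm: "continuous_on S m"
      unfolding m_def S_def
      by (intro continuous_on_add continuous_on_scaleR continuous_on_const continuous_on_snd continuous_on_id
          continuous_on_compose2[OF smooth_on_continuous_on[OF smooth_\<Phi>]]
          continuous_on_compose2[OF continuous_on_R] continuous_on_fst)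
         (use pres[OF F1] in auto)
    have 1: "((\<lambda>p. R (\<sigma> (fst p)) F1) has_derivative (\<lambda>p. coadjoint_field br (\<theta>' (fst p)) F1)) (at (e0, 0))"
      using has_derivative_compose[OF has_derivative_fst[OF has_derivative_ident], of "\<lambda>y. R (\<sigma> y) F1"
        "\<lambda>u. coadjoint_field br (\<theta>' u) F1" "(e0, 0)"] R_has_derivative by simp
    have dm: "(m has_derivative m') (at (e0, 0))"
      unfolding m_def m'_def
      using has_derivative_compose[OF 1, of \<Phi> "d\<Phi> F1"] \<Phi>_deriv[OF F1]
      by (intro has_derivative_add has_derivative_scaleR_left has_derivative_snd has_derivative_ident) simp
    have "surj m'"
    proof (rule surjI)
      fix w
      let ?v = "\<lambda>w. d\<Psi> (\<Phi> F1) (w - (w \<bullet> b) *\<^sub>R b)"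
      have "d\<Phi> F1 (?v w) \<bullet> b = 0" by (simp add: d\<Phi>_d\<Psi>[OF F1] inner_diff_left b_Basis)
      then have "coadjoint_field br (SOME u. coadjoint_field br u F1 = ?v w) F1 = ?v w"
        by (rule someI_ex[OF surj[OF F1]])
      then show "m' ((\<lambda>w. (\<theta> (SOME u. coadjoint_field br u F1 = ?v w), w \<bullet> b)) w) = w"
        by (simp add: m'_def d\<Phi>_d\<Psi>[OF F1])
    qed
    then obtain g where g: "linear g" "m' \<circ> g = id"
      using linear_surjective_right_inverse[OF has_derivative_linear[OF dm]] by blast
    have "m (e0, 0) \<in> interior (m ` S)"
      using g(1) by (intro sussmann_open_mapping[OF oS cm _ dm _ g(2)])
        (auto simp: S_def linear_conv_bounded_linear interior_open[OF oS, unfolded S_def])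
    then have in_int: "\<Phi> F1 \<in> interior (m ` S)" by (simp add: m_def)
    define N where "N = V \<inter> \<Phi> -` interior (m ` S)"
    have "open N"
      unfolding N_def by (intro continuous_open_preimage smooth_on_continuous_on[OF smooth_\<Phi>] open_V open_interior)
    moreover have "F1 \<in> N" using F1 in_int by (simp add: N_def)
    moreover have "N \<inter> leaf F1 \<subseteq> range (\<lambda>g. R g F1)"
    proof
      fix F2 assume F2: "F2 \<in> N \<inter> leaf F1"
      then have "\<Phi> F2 \<in> m ` S" using interior_subset by (auto simp: N_def)
      then obtain y s where ys: "\<Phi> F2 = \<Phi> (R (\<sigma> y) F1) + s *\<^sub>R b" by (auto simp: m_def)
      have "\<Phi> F2 \<bullet> b = \<Phi> F1 \<bullet> b" "\<Phi> (R (\<sigma> y) F1) \<bullet> b = \<Phi> F1 \<bullet> b"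
        using F2 sub[OF F1, of "\<sigma> y"] by (auto simp: leaf_def)
      then have "s = 0" using ys b_Basis by (simp add: inner_add_left)
      then have "\<Psi> (\<Phi> F2) = \<Psi> (\<Phi> (R (\<sigma> y) F1))" using ys by simp
      then have "F2 = R (\<sigma> y) F1" using \<Psi>_\<Phi> F2 pres[OF F1] by (simp add: N_def)
      then show "F2 \<in> range (\<lambda>g. R g F1)" by blast
    qed
    ultimately show ?thesis by blast
  qed
  have "range (\<lambda>g. R g F) = range (\<lambda>g. R g F2)" if F2: "F2 \<in> leaf F" for F2
  proof (rule connected_local_const[of "leaf F" F F2])
    show "connected (leaf F)" unfolding leaf_def by (rule connected_piece)
    show "\<forall>F1\<in>leaf F. \<forall>\<^sub>F F2 in at F1 within leaf F. range (\<lambda>g. R g F1) = range (\<lambda>g. R g F2)"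
    proof
      fix F1 assume F1: "F1 \<in> leaf F"
      then obtain N where N: "open N" "F1 \<in> N" "N \<inter> leaf F1 \<subseteq> range (\<lambda>g. R g F1)"
        using loc leaf_subset by blast
      have "\<forall>F2\<in>N. F2 \<noteq> F1 \<longrightarrow> F2 \<in> leaf F \<longrightarrow> range (\<lambda>g. R g F1) = range (\<lambda>g. R g F2)"
        using N(3) R_orbit_eq unfolding leaf_eq[OF F1] by blast
      then show "\<forall>\<^sub>F F2 in at F1 within leaf F. range (\<lambda>g. R g F1) = range (\<lambda>g. R g F2)"
        unfolding eventually_at_topological using N(1,2) by blast
    qed
  qed (use F2 leaf_refl[OF F] in auto)
  moreover have "F2 \<in> range (\<lambda>g. R g F2)" for F2 by (rule range_eqI[of _ _ \<one>]) simp
  ultimately show ?thesis using sub[OF F] by blast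
qed

end

section \<open>Functions affine in one coordinate straighten their level sets\<close>

lemma UNIV_coord: "UNIV = {X1, X2, X3, X4, X5, XX, YY}"
  using coord.exhaust by auto

lemma CARD_coord: "CARD(coord) = 7"
  unfolding UNIV_coord by simp

lemma bas_nth: "bas i $ j = (if i = j then 1 else 0)"
  by (simp add: axis_def)

definition quadrant :: "real ^ coord \<Rightarrow> real \<times> real"
  where "quadrant F = (sgn (F $ X4), sgn (F $ X5))"

lemma sgn_nonzero_fibre:
  "open {F::real^'n. F $ i \<noteq> 0 \<and> sgn (F $ i) = s}" "convex {F::real^'n. F $ i \<noteq> 0 \<and> sgn (F $ i) = s}"
proof -
  consider "s = 1" | "s = -1" | "s \<noteq> 1" "s \<noteq> -1" by blast
  then have "open {F::real^'n. F $ i \<noteq> 0 \<and> sgn (F $ i) = s} \<and> convex {F::real^'n. F $ i \<noteq> 0 \<and> sgn (F $ i) = s}"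
  proof cases
    case 1
    then have "{F::real^'n. F $ i \<noteq> 0 \<and> sgn (F $ i) = s} = {F. F \<bullet> axis i 1 > 0}"
      by (auto simp: sgn_if inner_axis)
    then show ?thesis
      using open_halfspace_gt[of 0 "axis i 1 :: real^'n"] convex_halfspace_gt[of 0 "axis i 1 :: real^'n"] by (simp add: inner_commute)
  next
    case 2
    then have "{F::real^'n. F $ i \<noteq> 0 \<and> sgn (F $ i) = s} = {F. F \<bullet> axis i 1 < 0}"
      by (auto simp: sgn_if inner_axis)
    then show ?thesis
      using open_halfspace_lt[of "axis i 1 :: real^'n" 0] convex_halfspace_lt[of "axis i 1 :: real^'n" 0] by (simp add: inner_commute)
  next
    case 3
    then have empty: "{F::real^'n. F $ i \<noteq> 0 \<and> sgn (F $ i) = s} = {}"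
      by (auto simp: sgn_if)
    show ?thesis unfolding empty by simp
  qed
  then show "open {F::real^'n. F $ i \<noteq> 0 \<and> sgn (F $ i) = s}" "convex {F::real^'n. F $ i \<noteq> 0 \<and> sgn (F $ i) = s}"
    by auto
qed

lemma quadrant_fibre:
  "open {F. F $ X4 * F $ X5 \<noteq> 0 \<and> quadrant F = k}" "convex {F. F $ X4 * F $ X5 \<noteq> 0 \<and> quadrant F = k}"
proof -
  have "{F. F $ X4 * F $ X5 \<noteq> 0 \<and> quadrant F = k} =
      {F. F $ X4 \<noteq> 0 \<and> sgn (F $ X4) = fst k} \<inter> {F. F $ X5 \<noteq> 0 \<and> sgn (F $ X5) = snd k}"
    by (auto simp: quadrant_def)
  then show "open {F. F $ X4 * F $ X5 \<noteq> 0 \<and> quadrant F = k}" "convex {F. F $ X4 * F $ X5 \<noteq> 0 \<and> quadrant F = k}"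
    by (simp_all only: open_Int convex_Int sgn_nonzero_fibre)
qed

text \<open>On this set all five invariants are defined, and the coadjoint orbits have dimension 6.\<close>

definition regular :: "(real ^ coord) set"
  where "regular = {F. F $ X4 * F $ X5 \<noteq> 0}"

lemma regularD: "F \<in> regular \<Longrightarrow> F $ X4 \<noteq> 0" "F \<in> regular \<Longrightarrow> F $ X5 \<noteq> 0"
  by (simp_all add: regular_def)

lemma open_regular: "open regular"
  unfolding regular_def by (intro open_Collect_neq continuous_intros)

lemma smooth_nth: "smooth_on regular (\<lambda>F. F $ i)"
  by (rule smooth_on_linear[OF open_regular bounded_linear_vec_nth smooth_on_id[OF open_regular]])

text \<open>A function \<open>p x2 + q\<close> with \<open>p\<close> and \<open>q\<close> independent of \<open>x2\<close> can be solved for \<open>x2\<close>, so that replacing \<open>x2\<close> by its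
  value is a diffeomorphism whose inverse is again given by a formula.\<close>

locale affine_invariant =
  fixes p q :: "real ^ coord \<Rightarrow> real"
  assumes smooth_p: "smooth_on regular p" and smooth_q: "smooth_on regular q"
    and p_nonzero: "F \<in> regular \<Longrightarrow> p F \<noteq> 0"
    and p_indep: "p (F + s *\<^sub>R bas X2) = p F" and q_indep: "q (F + s *\<^sub>R bas X2) = q F"
begin

definition invariant :: "real ^ coord \<Rightarrow> real"
  where "invariant F = p F * F $ X2 + q F"

definition straighten :: "real ^ coord \<Rightarrow> real ^ coord"
  where "straighten F = F + (invariant F - F $ X2) *\<^sub>R bas X2"

definition unstraighten :: "real ^ coord \<Rightarrow> real ^ coord"
  where "unstraighten z = z + ((z $ X2 - q z) / p z - z $ X2) *\<^sub>R bas X2"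

lemma smooth_invariant: "smooth_on regular invariant"
  unfolding invariant_def[abs_def] by (intro smooth_on_add smooth_on_mult open_regular smooth_p smooth_q smooth_nth)

lemma straightened_foliation: "straightened_foliation regular regular straighten unstraighten (bas X2) quadrant"
proof
  show "open regular" by (rule open_regular)
  show "smooth_on regular straighten"
    unfolding straighten_def[abs_def]
    by (intro smooth_on_add smooth_on_bilinear[OF _ bounded_bilinear_scaleR] smooth_on_diff smooth_on_id
        smooth_on_const smooth_nth smooth_invariant open_regular)
  show "smooth_on regular unstraighten"
    unfolding unstraighten_def[abs_def]
    by (intro smooth_on_add smooth_on_bilinear[OF _ bounded_bilinear_scaleR] smooth_on_diff smooth_on_id
        smooth_on_const smooth_nth smooth_on_divide smooth_p smooth_q p_nonzero open_regular)
  show st_in: "straighten F \<in> regular" if "F \<in> regular" for F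
    using that by (simp add: regular_def straighten_def bas_nth)
  show un_in: "unstraighten z \<in> regular" if "z \<in> regular" for z
    using that by (simp add: regular_def unstraighten_def bas_nth)
  show "unstraighten (straighten F) = F" if "F \<in> regular" for F
  proof -
    have "straighten F $ X2 = invariant F" "p (straighten F) = p F" "q (straighten F) = q F"
      by (simp_all add: straighten_def p_indep q_indep)
    then show ?thesis
      unfolding unstraighten_def using p_nonzero[OF that]
      by (simp add: invariant_def straighten_def flip: scaleR_left_distrib add.assoc)
  qed
  show st_un: "straighten (unstraighten z) = z" if "z \<in> regular" for z
  proof -
    have "unstraighten z $ X2 = (z $ X2 - q z) / p z" "p (unstraighten z) = p z" "q (unstraighten z) = q z"
      by (simp_all add: unstraighten_def p_indep q_indep)
    then show ?thesis
      unfolding straighten_def invariant_def using p_nonzero[OF that]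
      by (simp add: unstraighten_def flip: scaleR_left_distrib add.assoc)
  qed
  show "bas X2 \<in> Basis" by (auto simp: Basis_vec_def)
  show "open {F \<in> regular. quadrant F = k}" for k
    using quadrant_fibre(1) by (simp add: regular_def)
  show "connected {F \<in> regular. quadrant F = k \<and> straighten F \<bullet> bas X2 = c}" for k c
  proof -
    define Q where "Q = {z \<in> regular. quadrant z = k} \<inter> {z. bas X2 \<bullet> z = c}"
    have "convex Q"
      unfolding Q_def using quadrant_fibre(2) by (intro convex_Int convex_hyperplane) (simp add: regular_def)
    moreover have "Q \<subseteq> regular" by (auto simp: Q_def)
    ultimately have "connected (unstraighten ` Q)"
      using smooth_on_continuous_on[OF \<open>smooth_on regular unstraighten\<close>]
      by (intro connected_continuous_image convex_connected) (auto intro: continuous_on_subset)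
    moreover have qu: "quadrant (unstraighten z) = quadrant z" "quadrant (straighten z) = quadrant z" for z
      by (simp_all add: quadrant_def unstraighten_def straighten_def bas_nth)
    have "unstraighten ` Q = {F \<in> regular. quadrant F = k \<and> straighten F \<bullet> bas X2 = c}"
    proof (intro equalityI subsetI)
      fix F assume "F \<in> unstraighten ` Q"
      then show "F \<in> {F \<in> regular. quadrant F = k \<and> straighten F \<bullet> bas X2 = c}"
        using qu st_un un_in by (auto simp: Q_def inner_commute)
    next
      fix F assume "F \<in> {F \<in> regular. quadrant F = k \<and> straighten F \<bullet> bas X2 = c}"
      then show "F \<in> unstraighten ` Q"
        using qu st_in \<open>\<And>F. F \<in> regular \<Longrightarrow> unstraighten (straighten F) = F\<close>
        by (intro image_eqI[of _ _ "straighten F"]) (auto simp: Q_def inner_commute)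
    qed
    ultimately show ?thesis by simp
  qed
qed

lemma straighten_derivative:
  assumes "(invariant has_derivative f') (at F)"
  shows "frechet_derivative straighten (at F) v \<bullet> bas X2 = f' v"
proof -
  have "(straighten has_derivative (\<lambda>v. v + (f' v - v $ X2) *\<^sub>R bas X2)) (at F)"
    unfolding straighten_def[abs_def]
    by (intro has_derivative_add has_derivative_scaleR_left has_derivative_diff has_derivative_ident assms
        bounded_linear.has_derivative[OF bounded_linear_vec_nth])
  from fun_cong[OF frechet_derivative_at[OF this], of v]
  have "frechet_derivative straighten (at F) v = v + (f' v - v $ X2) *\<^sub>R bas X2" ..
  then show ?thesis by (simp add: inner_axis)
qed

end

text \<open>What remains to be checked for a concrete bracket is algebra: \<open>X4\<close> and \<open>X5\<close> span ideals, the function is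
  infinitesimally invariant, and the coadjoint fields span the kernel of its derivative.\<close>

lemma (in coadjoint_action) coadjoint_orbits_measurable_foliation:
  assumes aff: "affine_invariant p q"
    and eig: "\<And>u. \<exists>c. br u (bas X4) = c *\<^sub>R bas X4" "\<And>u. \<exists>c. br u (bas X5) = c *\<^sub>R bas X5"
    and deriv: "\<And>F. F \<in> regular \<Longrightarrow> ((\<lambda>F. p F * F $ X2 + q F) has_derivative f' F) (at F)"
    and tang: "\<And>F u. F \<in> regular \<Longrightarrow> f' F (coadjoint_field br u F) = 0"
    and surj: "\<And>F v. F \<in> regular \<Longrightarrow> f' F v = 0 \<Longrightarrow> \<exists>u. coadjoint_field br u F = v"
  shows "\<exists>D. foliation regular 6 D \<and>
             leaves regular 6 D = {coadjoint_orbit G (U, \<phi>) \<theta> F | F. F \<in> regular} \<and>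
             measurable_foliation regular 6 D"
proof -
  interpret I: affine_invariant p q by fact
  interpret S: straightened_foliation regular regular I.straighten I.unstraighten "bas X2" quadrant
    by (rule I.straightened_foliation)
  have d: "frechet_derivative I.straighten (at F) v \<bullet> bas X2 = f' F v" if "F \<in> regular" for F v
    by (rule I.straighten_derivative) (use deriv[OF that] in \<open>simp add: I.invariant_def[abs_def]\<close>)
  have sc: "\<exists>a>0. R g F $ i = a * F $ i" if e: "\<And>u. \<exists>c. br u (bas i) = c *\<^sub>R bas i" for g F i
  proof -
    obtain a where "a > 0" "\<rho> g (bas i) = a *\<^sub>R bas i"
      using \<rho>_eigenvector[OF e] by (auto simp: axis_eq_0_iff)
    moreover have "R g F $ i = F \<bullet> \<rho> g (bas i)" by (simp add: R_def)
    ultimately show ?thesis by (auto simp: inner_axis)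
  qed
  have pres: "R g F \<in> regular \<and> quadrant (R g F) = quadrant F" if "F \<in> regular" for g F
  proof -
    obtain a c where "a > 0" "R g F $ X4 = a * F $ X4" "c > 0" "R g F $ X5 = c * F $ X5"
      using sc[OF eig(1)] sc[OF eig(2)] by metis
    then show ?thesis using that by (simp add: regular_def quadrant_def sgn_mult)
  qed
  have leaf: "coadjoint_orbit G (U, \<phi>) \<theta> F = S.leaf F" if "F \<in> regular" for F
    unfolding coadjoint_orbit_eq
    by (rule orbit_eq_leaf[OF I.straightened_foliation pres _ _ that]) (use d tang surj in auto)
  have dim: "DIM(real ^ coord) - 1 = 6" by (simp add: CARD_coord)
  have "regular \<noteq> {}"
  proof -
    have "(\<chi> i. 1) \<in> regular" unfolding regular_def by simp
    then show ?thesis by blast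
  qed
  then have "measurable_foliation regular 6 S.D" using S.measurable_foliation_D unfolding dim by blast
  moreover have "foliation regular 6 S.D" using S.foliation_D unfolding dim .
  moreover have "leaves regular 6 S.D = {coadjoint_orbit G (U, \<phi>) \<theta> F | F. F \<in> regular}"
    using S.leaves_eq unfolding dim Setcompr_eq_image by (simp add: leaf)
  ultimately show ?thesis by blast
qed

section \<open>The invariants of the five algebras\<close>

lemma all_coord: "(\<forall>i. P i) \<longleftrightarrow> P X1 \<and> P X2 \<and> P X3 \<and> P X4 \<and> P X5 \<and> P XX \<and> P YY"
  by (metis coord.exhaust)

lemma inner_bas: "F \<bullet> bas i = F $ i"
  by (simp add: inner_axis)

lemma has_derivative_nth: "((\<lambda>F. F $ i) has_derivative (\<lambda>v. v $ i)) (at (F :: real ^ 'n))"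
  by (rule bounded_linear.has_derivative[OF bounded_linear_vec_nth has_derivative_ident])

lemma has_derivative_ln_abs_nth:
  "F $ i \<noteq> 0 \<Longrightarrow> ((\<lambda>F. ln \<bar>F $ i\<bar>) has_derivative (\<lambda>v. v $ i / F $ i)) (at (F :: real ^ 'n))"
  using has_derivative_compose[OF has_derivative_nth has_derivative_ln_abs] .

lemmas bracket_simps = bracket_of_def bas_nth inner_bas inner_add_right inner_diff_right inner_minus_right

lemmas has_derivative_coord_intros = has_derivative_add has_derivative_diff has_derivative_minus
  has_derivative_mult has_derivative_divide' has_derivative_const has_derivative_nth
  has_derivative_ln_abs_nth

lemmas smooth_coord_intros = smooth_on_add smooth_on_diff smooth_on_minus smooth_on_mult
  smooth_on_divide smooth_on_ln_abs smooth_on_const smooth_nth open_regular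

context coadjoint_action
begin

abbreviation (input) orbits_form_measurable_foliation :: bool where
  "orbits_form_measurable_foliation \<equiv> \<exists>D. foliation regular 6 D \<and>
     leaves regular 6 D = {coadjoint_orbit G (U, \<phi>) \<theta> F | F. F \<in> regular} \<and>
     measurable_foliation regular 6 D"

text \<open>The invariant is \<open>x2 - x3 x4 / x5\<close>, which is \<open>x4 (x2/x4 - x3/x5)\<close>: the field of \<open>X\<close> scales \<open>x4\<close> and \<open>x5\<close>
  together, hence \<open>x2/x4 - x3/x5\<close> inversely, and the factor \<open>x4\<close> compensates.\<close>

lemma coadjoint_orbits_G2:
  assumes br: "br = bracket_G2"
  shows orbits_form_measurable_foliation
proof (rule coadjoint_orbits_measurable_foliation)
  let ?p = "\<lambda>F. 1" and ?q = "\<lambda>F. - (F $ X3 * F $ X4 / F $ X5)"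
  let ?f' = "\<lambda>F v. v $ X2 - v $ X3 * F $ X4 / F $ X5 - F $ X3 * v $ X4 / F $ X5 + F $ X3 * F $ X4 * v $ X5 / (F $ X5)\<^sup>2"
  show "affine_invariant ?p ?q"
    by unfold_locales (auto simp: regularD bas_nth intro!: smooth_coord_intros)
  show "((\<lambda>F. ?p F * F $ X2 + ?q F) has_derivative ?f' F) (at F)" if "F \<in> regular" for F
    using regularD[OF that]
    by - (rule has_derivative_eq_rhs, (rule has_derivative_coord_intros | assumption)+,
      auto simp: field_simps power2_eq_square)
  show "?f' F (coadjoint_field br u F) = 0" if "F \<in> regular" for F u
    using that by (simp add: regular_def br coadjoint_field_def bracket_G2_def bracket_simps vec_eq_iff all_coord field_simps power2_eq_square)
  show "\<exists>u. coadjoint_field br u F = v" if "F \<in> regular" "?f' F v = 0" for F v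
  proof
    \<comment> \<open>The unique solution with vanishing \<open>X3\<close>-component.\<close>
    let ?ux = "v $ X4 / F $ X4" and ?u1 = "v $ X2 / F $ X4" and ?u5 = "- v $ YY / F $ X5"
    let ?u = "\<chi> i. case i of X1 \<Rightarrow> ?u1 | X2 \<Rightarrow> (?ux * F $ X1 - v $ X1) / F $ X4 | X3 \<Rightarrow> 0
        | X4 \<Rightarrow> - (v $ XX + ?u1 * F $ X1 + ?u5 * F $ X5) / F $ X4 | X5 \<Rightarrow> ?u5
        | XX \<Rightarrow> ?ux | YY \<Rightarrow> v $ X5 / F $ X5 - ?ux"
    have v3: "v $ X3 = (v $ X2 - F $ X3 * v $ X4 / F $ X5 + F $ X3 * F $ X4 * v $ X5 / (F $ X5)\<^sup>2) * F $ X5 / F $ X4"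
      using that regularD[OF that(1)] by (simp add: field_simps power2_eq_square)
    show "coadjoint_field br ?u F = v"
      using that(1) by (simp add: v3 regular_def br coadjoint_field_def bracket_G2_def bracket_simps vec_eq_iff all_coord field_simps power2_eq_square)
  qed
  show "\<exists>c. br u (bas X4) = c *\<^sub>R bas X4" "\<exists>c. br u (bas X5) = c *\<^sub>R bas X5" for u
    by (auto simp: br bracket_G2_def bracket_simps vec_eq_iff all_coord)
qed

text \<open>The invariant is \<open>x2/x4 - x3/x5\<close>: \<open>X\<close> scales the pair \<open>(x2, x4)\<close> and \<open>Y\<close> the pair \<open>(x3, x5)\<close>, so both quotients are
  kept, while \<open>X1\<close> moves both with speed 1.\<close>

lemma coadjoint_orbits_G3:
  assumes br: "br = bracket_G3"
  shows orbits_form_measurable_foliation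
proof (rule coadjoint_orbits_measurable_foliation)
  let ?p = "\<lambda>F. 1 / F $ X4" and ?q = "\<lambda>F. - (F $ X3 / F $ X5)"
  let ?f' = "\<lambda>F v. v $ X2 / F $ X4 - F $ X2 * v $ X4 / (F $ X4)\<^sup>2 - v $ X3 / F $ X5 + F $ X3 * v $ X5 / (F $ X5)\<^sup>2"
  show "affine_invariant ?p ?q"
    by unfold_locales (auto simp: regularD bas_nth intro!: smooth_coord_intros)
  show "((\<lambda>F. ?p F * F $ X2 + ?q F) has_derivative ?f' F) (at F)" if "F \<in> regular" for F
    using regularD[OF that]
    by - (rule has_derivative_eq_rhs, (rule has_derivative_coord_intros | assumption)+,
      auto simp: field_simps power2_eq_square)
  show "?f' F (coadjoint_field br u F) = 0" if "F \<in> regular" for F u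
    using that by (simp add: regular_def br coadjoint_field_def bracket_G3_def bracket_simps vec_eq_iff all_coord field_simps power2_eq_square)
  show "\<exists>u. coadjoint_field br u F = v" if "F \<in> regular" "?f' F v = 0" for F v
  proof
    \<comment> \<open>The unique solution with vanishing \<open>X3\<close>-component.\<close>
    let ?ux = "v $ X4 / F $ X4" and ?u2 = "- v $ X1 / F $ X4"
    let ?u = "\<chi> i. case i of X1 \<Rightarrow> (v $ X2 - ?ux * F $ X2) / F $ X4 | X2 \<Rightarrow> ?u2 | X3 \<Rightarrow> 0
        | X4 \<Rightarrow> - (v $ XX + ?u2 * F $ X2) / F $ X4 | X5 \<Rightarrow> - v $ YY / F $ X5
        | XX \<Rightarrow> ?ux | YY \<Rightarrow> v $ X5 / F $ X5"
    have v3: "v $ X3 = F $ X5 * (v $ X2 / F $ X4 - F $ X2 * v $ X4 / (F $ X4)\<^sup>2 + F $ X3 * v $ X5 / (F $ X5)\<^sup>2)"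
      using that regularD[OF that(1)] by (simp add: field_simps power2_eq_square)
    show "coadjoint_field br ?u F = v"
      using that(1) by (simp add: v3 regular_def br coadjoint_field_def bracket_G3_def bracket_simps vec_eq_iff all_coord field_simps power2_eq_square)
  qed
  show "\<exists>c. br u (bas X4) = c *\<^sub>R bas X4" "\<exists>c. br u (bas X5) = c *\<^sub>R bas X5" for u
    by (auto simp: br bracket_G3_def bracket_simps vec_eq_iff all_coord)
qed

text \<open>This algebra is obtained from the one of \<open>bracket_G2\<close> by exchanging \<open>X2\<close> with \<open>X3\<close> and \<open>X4\<close> with \<open>X5\<close>; the invariant is
  \<open>x5 (x2/x4 - x3/x5)\<close>.\<close>

lemma coadjoint_orbits_G4_00:
  assumes br: "br = bracket_G4_00"
  shows orbits_form_measurable_foliation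
proof (rule coadjoint_orbits_measurable_foliation)
  let ?p = "\<lambda>F. F $ X5 / F $ X4" and ?q = "\<lambda>F. - F $ X3"
  let ?f' = "\<lambda>F v. F $ X5 * v $ X2 / F $ X4 + F $ X2 * v $ X5 / F $ X4 - F $ X2 * F $ X5 * v $ X4 / (F $ X4)\<^sup>2 - v $ X3"
  show "affine_invariant ?p ?q"
    by unfold_locales (auto simp: regularD bas_nth intro!: smooth_coord_intros)
  show "((\<lambda>F. ?p F * F $ X2 + ?q F) has_derivative ?f' F) (at F)" if "F \<in> regular" for F
    using regularD[OF that]
    by - (rule has_derivative_eq_rhs, (rule has_derivative_coord_intros | assumption)+,
      auto simp: field_simps power2_eq_square)
  show "?f' F (coadjoint_field br u F) = 0" if "F \<in> regular" for F u
    using that by (simp add: regular_def br coadjoint_field_def bracket_G4_00_def bracket_simps vec_eq_iff all_coord field_simps power2_eq_square)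
  show "\<exists>u. coadjoint_field br u F = v" if "F \<in> regular" "?f' F v = 0" for F v
  proof
    \<comment> \<open>The unique solution with vanishing \<open>X2\<close>-component.\<close>
    let ?ux = "v $ X5 / F $ X5" and ?u1 = "v $ X3 / F $ X5" and ?u4 = "- v $ YY / F $ X4"
    let ?u = "\<chi> i. case i of X1 \<Rightarrow> ?u1 | X2 \<Rightarrow> 0 | X3 \<Rightarrow> (?ux * F $ X1 - v $ X1) / F $ X5
        | X4 \<Rightarrow> ?u4 | X5 \<Rightarrow> - (v $ XX + ?u1 * F $ X1 + ?u4 * F $ X4) / F $ X5
        | XX \<Rightarrow> ?ux | YY \<Rightarrow> v $ X4 / F $ X4 - ?ux"
    have v3: "v $ X3 = F $ X5 * v $ X2 / F $ X4 + F $ X2 * v $ X5 / F $ X4 - F $ X2 * F $ X5 * v $ X4 / (F $ X4)\<^sup>2"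
      using that regularD[OF that(1)] by (simp add: field_simps power2_eq_square)
    show "coadjoint_field br ?u F = v"
      using that(1) by (simp add: v3 regular_def br coadjoint_field_def bracket_G4_00_def bracket_simps vec_eq_iff all_coord field_simps power2_eq_square)
  qed
  show "\<exists>c. br u (bas X4) = c *\<^sub>R bas X4" "\<exists>c. br u (bas X5) = c *\<^sub>R bas X5" for u
    by (auto simp: br bracket_G4_00_def bracket_simps vec_eq_iff all_coord)
qed

text \<open>Because of \<open>[Y, X3] = X5\<close>, the field of \<open>Y\<close> lowers \<open>x2/x4 - x3/x5\<close> with speed 1; adding \<open>ln \<bar>x4\<bar>\<close>, which \<open>Y\<close> raises with
  speed 1 and \<open>X\<close> leaves alone, restores invariance.\<close>

lemma coadjoint_orbits_G9:
  assumes br: "br = bracket_G9"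
  shows orbits_form_measurable_foliation
proof (rule coadjoint_orbits_measurable_foliation)
  let ?p = "\<lambda>F. 1 / F $ X4" and ?q = "\<lambda>F. - (F $ X3 / F $ X5) + ln \<bar>F $ X4\<bar>"
  let ?f' = "\<lambda>F v. v $ X2 / F $ X4 - F $ X2 * v $ X4 / (F $ X4)\<^sup>2 - v $ X3 / F $ X5 + F $ X3 * v $ X5 / (F $ X5)\<^sup>2 + v $ X4 / F $ X4"
  show "affine_invariant ?p ?q"
    by unfold_locales (auto simp: regularD bas_nth intro!: smooth_coord_intros)
  show "((\<lambda>F. ?p F * F $ X2 + ?q F) has_derivative ?f' F) (at F)" if "F \<in> regular" for F
    using regularD[OF that]
    by - (rule has_derivative_eq_rhs, (rule has_derivative_coord_intros | assumption)+,
      auto simp: field_simps power2_eq_square)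
  show "?f' F (coadjoint_field br u F) = 0" if "F \<in> regular" for F u
    using that by (simp add: regular_def br coadjoint_field_def bracket_G9_def bracket_simps vec_eq_iff all_coord field_simps power2_eq_square)
  show "\<exists>u. coadjoint_field br u F = v" if "F \<in> regular" "?f' F v = 0" for F v
  proof
    \<comment> \<open>The unique solution with vanishing \<open>X3\<close>-component.\<close>
    let ?uy = "v $ X4 / F $ X4" and ?u2 = "- v $ X1 / F $ X4"
    let ?u = "\<chi> i. case i of X1 \<Rightarrow> (v $ X2 - ?uy * F $ X2) / F $ X4 | X2 \<Rightarrow> ?u2 | X3 \<Rightarrow> 0
        | X4 \<Rightarrow> - (v $ YY + ?u2 * F $ X2) / F $ X4 | X5 \<Rightarrow> - v $ XX / F $ X5
        | XX \<Rightarrow> v $ X5 / F $ X5 | YY \<Rightarrow> ?uy"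
    have v3: "v $ X3 = F $ X5 * (v $ X2 / F $ X4 - F $ X2 * v $ X4 / (F $ X4)\<^sup>2 + F $ X3 * v $ X5 / (F $ X5)\<^sup>2 + v $ X4 / F $ X4)"
      using that regularD[OF that(1)] by (simp add: field_simps power2_eq_square)
    show "coadjoint_field br ?u F = v"
      using that(1) by (simp add: v3 regular_def br coadjoint_field_def bracket_G9_def bracket_simps vec_eq_iff all_coord field_simps power2_eq_square)
  qed
  show "\<exists>c. br u (bas X4) = c *\<^sub>R bas X4" "\<exists>c. br u (bas X5) = c *\<^sub>R bas X5" for u
    by (auto simp: br bracket_G9_def bracket_simps vec_eq_iff all_coord)
qed

text \<open>As for \<open>bracket_G9\<close>, the field of \<open>Y\<close> lowers \<open>x2/x4 - x3/x5\<close> with speed 1. The correction \<open>ln \<bar>x5\<bar>\<close> is raised by \<open>Y\<close> but also, with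
  speed \<open>l\<close>, by \<open>X\<close>; subtracting \<open>l ln \<bar>x4\<bar>\<close> removes the latter.\<close>

lemma coadjoint_orbits_G10:
  assumes br: "br = bracket_G10 l"
  shows orbits_form_measurable_foliation
proof (rule coadjoint_orbits_measurable_foliation)
  let ?p = "\<lambda>F. 1 / F $ X4" and ?q = "\<lambda>F. - (F $ X3 / F $ X5) + (ln \<bar>F $ X5\<bar> - l * ln \<bar>F $ X4\<bar>)"
  let ?f' = "\<lambda>F v. v $ X2 / F $ X4 - F $ X2 * v $ X4 / (F $ X4)\<^sup>2 - v $ X3 / F $ X5 + F $ X3 * v $ X5 / (F $ X5)\<^sup>2 + v $ X5 / F $ X5 - l * v $ X4 / F $ X4"
  show "affine_invariant ?p ?q"
    by unfold_locales (auto simp: regularD bas_nth intro!: smooth_coord_intros)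
  show "((\<lambda>F. ?p F * F $ X2 + ?q F) has_derivative ?f' F) (at F)" if "F \<in> regular" for F
    using regularD[OF that]
    by - (rule has_derivative_eq_rhs, (rule has_derivative_coord_intros | assumption)+,
      auto simp: field_simps power2_eq_square)
  show "?f' F (coadjoint_field br u F) = 0" if "F \<in> regular" for F u
    using that by (simp add: regular_def br coadjoint_field_def bracket_G10_def bracket_simps vec_eq_iff all_coord field_simps power2_eq_square)
  show "\<exists>u. coadjoint_field br u F = v" if "F \<in> regular" "?f' F v = 0" for F v
  proof
    \<comment> \<open>The unique solution with vanishing \<open>X3\<close>-component.\<close>
    let ?ux = "v $ X4 / F $ X4" and ?u2 = "- v $ X1 / F $ X4" and ?u5 = "- v $ YY / F $ X5"
    let ?u = "\<chi> i. case i of X1 \<Rightarrow> (v $ X2 - ?ux * F $ X2) / F $ X4 | X2 \<Rightarrow> ?u2 | X3 \<Rightarrow> 0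
        | X4 \<Rightarrow> - (v $ XX + ?u2 * F $ X2 + l * ?u5 * F $ X5) / F $ X4 | X5 \<Rightarrow> ?u5
        | XX \<Rightarrow> ?ux | YY \<Rightarrow> v $ X5 / F $ X5 - l * ?ux"
    have v3: "v $ X3 = F $ X5 * (v $ X2 / F $ X4 - F $ X2 * v $ X4 / (F $ X4)\<^sup>2 + F $ X3 * v $ X5 / (F $ X5)\<^sup>2 + v $ X5 / F $ X5 - l * v $ X4 / F $ X4)"
      using that regularD[OF that(1)] by (simp add: field_simps power2_eq_square)
    show "coadjoint_field br ?u F = v"
      using that(1) by (simp add: v3 regular_def br coadjoint_field_def bracket_G10_def bracket_simps vec_eq_iff all_coord field_simps power2_eq_square)
  qed
  show "\<exists>c. br u (bas X4) = c *\<^sub>R bas X4" "\<exists>c. br u (bas X5) = c *\<^sub>R bas X5" for u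
    by (auto simp: br bracket_G10_def bracket_simps vec_eq_iff all_coord)
qed

end

section \<open>Connes measurability of the orbit foliations\<close>

theorem theorem3p5:
  fixes G :: "'g::{t2_space, second_countable_topology} monoid"
    and A :: "('g, 'e::euclidean_space) chart set"
    and c :: "('g, 'e) chart"
    and br :: "real ^ coord \<Rightarrow> real ^ coord \<Rightarrow> real ^ coord"
    and \<theta> :: "real ^ coord \<Rightarrow> 'e"
    and V :: "(real ^ coord) set"
  assumes "br \<in> {bracket_G2, bracket_G3, bracket_G4_00, bracket_G9} \<union> range bracket_G10"
    and "lie_group G A"
    and "connected (UNIV :: 'g set)"
    and "simply_connected (UNIV :: 'g set)"
    and "c \<in> A" and "\<one>\<^bsub>G\<^esub> \<in> fst c"
    and "lie_algebra_iso br (group_bracket G c) \<theta>"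
    and "V = {F. F $ X4 * F $ X5 \<noteq> 0}"
  shows "\<exists>D. foliation V 6 D \<and>
             leaves V 6 D = {coadjoint_orbit G c \<theta> F | F. F \<in> V} \<and>
             measurable_foliation V 6 D"
proof -
  obtain U \<phi> where c: "c = (U, \<phi>)" by fastforce
  interpret coadjoint_action G A U \<phi> br \<theta>
    by unfold_locales (use assms(2,3,5,6,7) in \<open>simp_all add: c\<close>)
  have V: "V = regular" using assms(8) by (simp only: regular_def)
  consider "br = bracket_G2" | "br = bracket_G3" | "br = bracket_G4_00" | "br = bracket_G9"
    | l where "br = bracket_G10 l"
    using assms(1) by blast
  then have orbits_form_measurable_foliation
    by cases (fact coadjoint_orbits_G2 coadjoint_orbits_G3 coadjoint_orbits_G4_00
        coadjoint_orbits_G9 coadjoint_orbits_G10)+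
  then show ?thesis unfolding V c .
qed

end
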